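(* Let $Z_{XY}\in \mathfrak{X}^{S^1}_0\cup \mathfrak{X}^{S^1}_1$; that is, $Z_{XY}$ is a piecewise smooth vector field with discontinuity set $S^1$, given inside $S^1$ by a constant vector field $X$ and outside $S^1$ by an affine vector field $Y$ which either has a singularity of center type, or has a singularity of saddle type and satisfies $\operatorname{div}(Y)=0$. Then $Z_{XY}$ admits at most one crossing limit cycle that intersects $S^1$ in two points.
   Context: Let $S^1=\{(x,y)\in\mathbb R^2: x^2+y^2=1\}$ and $h(x,y)=x^2+y^2-1$. Let $U\subset\mathbb R^2$ be an open convex set with $(0,0)\in U$ and $S^1\subset U$. For smooth vector fields $X,Y$ on $U$, $Z_{XY}$ denotes the piecewise smooth vector field equal to $X$ where $h\le 0$ and to $Y$ where $h\ge 0$, with Filippov's convention on $S^1$. Write $Xh=\langle X,\nabla h\rangle$ and $Yh=\langle Y,\nabla h\rangle$. The crossing region is $\{z\in S^1: Xh(z)\,Yh(z)>0\}$; there, trajectories of $X$ and $Y$ are concatenated. A crossing periodic orbit is a closed nonconstant trajectory of $Z_{XY}$, obtained by concatenating arcs of $X$-trajectories in $h\le 0$ and arcs of $Y$-trajectories in $h\ge 0$, that meets $S^1$ only at points of the crossing region. A crossing limit cycle is a crossing periodic orbit having a neighbourhood that contains no other periodic orbit. "Intersects $S^1$ in two points" means in exactly two distinct points. "Linear vector field" means an affine vector field $z\mapsto Az+b$ with $A$ a real $2\times2$ matrix and $b\in\mathbb R^2$. Its singularity (possibly anywhere in the plane) is of center type if $A$ has nonzero purely imaginary eigenvalues, and of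 saddle type if $A$ has real eigenvalues of opposite signs. $\mathfrak{X}^{S^1}_0$ is the set of $Z_{XY}$ with $X$ constant and $Y$ linear with a singularity of center type. $\mathfrak{X}^{S^1}_1$ is the set of $Z_{XY}$ with $X$ constant and $Y$ linear with a singularity of saddle type and $\operatorname{div}(Y)=0$. *)

theory Defs
  imports "HOL-Analysis.Analysis"
begin

type_synonym vfield = "real^2 \<Rightarrow> real^2"

definition h :: "real^2 \<Rightarrow> real" where
  "h z = (z$1)\<^sup>2 + (z$2)\<^sup>2 - 1"

definition S1 :: "(real^2) set" where
  "S1 = {z. (z$1)\<^sup>2 + (z$2)\<^sup>2 = 1}"

definition grad :: "(real^2 \<Rightarrow> real) \<Rightarrow> vfield" where
  "grad f z = (THE D. GDERIV f z :> D)"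

definition lie :: "vfield \<Rightarrow> (real^2 \<Rightarrow> real) \<Rightarrow> real^2 \<Rightarrow> real" where
  "lie X f z = X z \<bullet> grad f z"

definition crossing_region :: "vfield \<Rightarrow> vfield \<Rightarrow> (real^2) set" where
  "crossing_region X Y = {z \<in> S1. lie X h z * lie Y h z > 0}"

text \<open>A piecewise smooth vector field is represented by its pair of smooth components
  \<open>X\<close> (used where \<open>h \<le> 0\<close>) and \<open>Y\<close> (used where \<open>h \<ge> 0\<close>); only the values on \<open>U\<close> matter.
  On the circle, Filippov's convention replaces the value by the segment joining the two
  one-sided values.\<close>

definition filippov :: "vfield \<Rightarrow> vfield \<Rightarrow> real^2 \<Rightarrow> (real^2) set" where
  "filippov X Y z =
     (if h z < 0 then {X z} else if h z > 0 then {Y z} else closed_segment (X z) (Y z))"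

text \<open>The conditions on \<open>v\<close> below say that \<open>\<gamma>\<close> is absolutely continuous on \<open>{0..T}\<close> and that its
  derivative lies in the Filippov set almost everywhere.  Orbits are taken as point sets.\<close>

definition periodic_orbit ::
  "(real^2) set \<Rightarrow> vfield \<Rightarrow> vfield \<Rightarrow> (real^2) set \<Rightarrow> bool" where
  "periodic_orbit U X Y \<Gamma> \<longleftrightarrow>
     (\<exists>\<gamma> v. \<exists>T::real. T > 0 \<and> \<Gamma> = \<gamma> ` {0..T} \<and> \<Gamma> \<subseteq> U \<and> \<gamma> T = \<gamma> 0 \<and> (\<exists>t\<in>{0..T}. \<gamma> t \<noteq> \<gamma> 0) \<and>
        v absolutely_integrable_on {0..T} \<and>
        (\<forall>t\<in>{0..T}. \<gamma> t = \<gamma> 0 + integral {0..t} v) \<and>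
        negligible {t \<in> {0..T}. v t \<notin> filippov X Y (\<gamma> t)})"

definition trajectory_arc :: "vfield \<Rightarrow> (real \<Rightarrow> real^2) \<Rightarrow> real \<Rightarrow> real \<Rightarrow> bool" where
  "trajectory_arc F \<gamma> a b \<longleftrightarrow>
     (\<forall>t\<in>{a..b}. (\<gamma> has_vector_derivative F (\<gamma> t)) (at t within {a..b}))"

definition crossing_periodic_orbit ::
  "(real^2) set \<Rightarrow> vfield \<Rightarrow> vfield \<Rightarrow> (real^2) set \<Rightarrow> bool" where
  "crossing_periodic_orbit U X Y \<Gamma> \<longleftrightarrow>
     (\<exists>\<gamma> T n \<tau>. T > 0 \<and> \<Gamma> = \<gamma> ` {0..T} \<and> \<Gamma> \<subseteq> U \<and> \<gamma> T = \<gamma> 0 \<and> (\<exists>t\<in>{0..T}. \<gamma> t \<noteq> \<gamma> 0) \<and>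
        \<tau> 0 = 0 \<and> \<tau> n = T \<and>
        (\<forall>i<n::nat. \<tau> i < \<tau> (Suc i) \<and>
           (trajectory_arc X \<gamma> (\<tau> i) (\<tau> (Suc i)) \<and> (\<forall>t\<in>{\<tau> i..\<tau> (Suc i)}. h (\<gamma> t) \<le> 0) \<or>
            trajectory_arc Y \<gamma> (\<tau> i) (\<tau> (Suc i)) \<and> (\<forall>t\<in>{\<tau> i..\<tau> (Suc i)}. h (\<gamma> t) \<ge> 0))) \<and>
        \<Gamma> \<inter> S1 \<subseteq> crossing_region X Y)"

definition crossing_limit_cycle ::
  "(real^2) set \<Rightarrow> vfield \<Rightarrow> vfield \<Rightarrow> (real^2) set \<Rightarrow> bool" where
  "crossing_limit_cycle U X Y \<Gamma> \<longleftrightarrow>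
     crossing_periodic_orbit U X Y \<Gamma> \<and>
     (\<exists>V. open V \<and> \<Gamma> \<subseteq> V \<and> (\<forall>\<Gamma>'. periodic_orbit U X Y \<Gamma>' \<and> \<Gamma>' \<subseteq> V \<longrightarrow> \<Gamma>' = \<Gamma>))"

definition eigenvalues :: "real^2^2 \<Rightarrow> complex set" where
  "eigenvalues A =
     {l. \<exists>v::complex^2. v \<noteq> 0 \<and> map_matrix complex_of_real A *v v = l *s v}"

definition constant_field :: "(real^2) set \<Rightarrow> vfield \<Rightarrow> bool" where
  "constant_field U X \<longleftrightarrow> (\<exists>c. \<forall>z\<in>U. X z = c)"

text \<open>The singularity \<open>p\<close> of the affine map is not required to lie in \<open>U\<close>.\<close>

definition linear_center :: "(real^2) set \<Rightarrow> vfield \<Rightarrow> bool" where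
  "linear_center U Y \<longleftrightarrow>
     (\<exists>A b p. (\<forall>z\<in>U. Y z = A *v z + b) \<and> A *v p + b = 0 \<and>
        (\<exists>w::real. w \<noteq> 0 \<and> eigenvalues A = {Complex 0 w, Complex 0 (- w)}))"

definition linear_saddle :: "(real^2) set \<Rightarrow> vfield \<Rightarrow> bool" where
  "linear_saddle U Y \<longleftrightarrow>
     (\<exists>A b p. (\<forall>z\<in>U. Y z = A *v z + b) \<and> A *v p + b = 0 \<and>
        (\<exists>r s::real. r < 0 \<and> 0 < s \<and> eigenvalues A = {complex_of_real r, complex_of_real s}))"

definition divergence :: "vfield \<Rightarrow> real^2 \<Rightarrow> real" where
  "divergence F z = trace (jacobian F (at z))"

definition X0 :: "(real^2) set \<Rightarrow> (vfield \<times> vfield) set" where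
  "X0 U = {(X, Y). constant_field U X \<and> linear_center U Y}"

definition X1 :: "(real^2) set \<Rightarrow> (vfield \<times> vfield) set" where
  "X1 U = {(X, Y). constant_field U X \<and> linear_saddle U Y \<and> (\<forall>z\<in>U. divergence Y z = 0)}"

lemma S1_eq: "S1 = {z. h z = 0}" "S1 = sphere 0 1"
  by (auto simp: S1_def h_def norm_vec_def L2_set_def sum_2)

lemma GDERIV_h: "GDERIV h z :> 2 *\<^sub>R z"
proof -
  have "((\<lambda>x::real^2. x $ i) has_derivative (\<lambda>x. x $ i)) (at z)" for i
    by (rule bounded_linear_imp_has_derivative[OF bounded_linear_vec_nth])
  note d = this[of 1] this[of 2]
  show ?thesis
    unfolding gderiv_def h_def
    by (rule derivative_eq_intros d refl)+ (simp add: inner_vec_def sum_2 fun_eq_iff)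
qed

lemma grad_h: "grad h z = 2 *\<^sub>R z"
  unfolding grad_def
proof (rule the_equality)
  fix D assume "GDERIV h z :> D"
  then have "(\<lambda>x. x \<bullet> D) = (\<lambda>x. x \<bullet> (2 *\<^sub>R z))"
    using GDERIV_h[of z] unfolding gderiv_def by (rule has_derivative_unique)
  then have "\<forall>x. x \<bullet> D = x \<bullet> (2 *\<^sub>R z)"
    by meson
  then show "D = 2 *\<^sub>R z"
    by (simp only: vector_eq_ldot)
qed (rule GDERIV_h)

lemma crossing_region_eq:
  "crossing_region X Y = {z \<in> S1. (X z \<bullet> z) * (Y z \<bullet> z) > 0}"
  by (auto simp: crossing_region_def lie_def grad_h zero_less_mult_iff)

lemma divergence_affine:
  assumes "open U" "z \<in> U" "\<forall>z\<in>U. Y z = A *v z + b"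
  shows "divergence Y z = trace A"
proof -
  have "((\<lambda>z. A *v z + b) has_derivative (\<lambda>z. A *v z)) (at z)"
    by (intro has_derivative_add_const bounded_linear_imp_has_derivative
        matrix_vector_mul_bounded_linear)
  then have "(Y has_derivative (\<lambda>z. A *v z)) (at z)"
    by (rule has_derivative_transform_within_open[OF _ assms(1,2)]) (use assms(3) in simp)
  from frechet_derivative_at[OF this, symmetric] show ?thesis
    by (simp add: divergence_def jacobian_def)
qed

lemma crossing_imp_periodic_orbit:
  assumes \<Gamma>: "crossing_periodic_orbit U X Y \<Gamma>"
    and cont: "continuous_on U X" "continuous_on U Y"
  shows "periodic_orbit U X Y \<Gamma>"
proof -
  obtain \<gamma> T n \<tau> where T: "T > 0" and im: "\<Gamma> = \<gamma> ` {0..T}" and sub: "\<Gamma> \<subseteq> U"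
    and cl: "\<gamma> T = \<gamma> 0" and nc: "\<exists>t\<in>{0..T}. \<gamma> t \<noteq> \<gamma> 0" and t0: "\<tau> 0 = 0" and tn: "\<tau> n = T"
    and arcs0: "\<forall>i<n. \<tau> i < \<tau> (Suc i) \<and>
           (trajectory_arc X \<gamma> (\<tau> i) (\<tau> (Suc i)) \<and> (\<forall>t\<in>{\<tau> i..\<tau> (Suc i)}. h (\<gamma> t) \<le> 0) \<or>
            trajectory_arc Y \<gamma> (\<tau> i) (\<tau> (Suc i)) \<and> (\<forall>t\<in>{\<tau> i..\<tau> (Suc i)}. h (\<gamma> t) \<ge> 0))"
    using \<Gamma> unfolding crossing_periodic_orbit_def
    by (elim exE conjE) (rule that; assumption)
  note arcs = arcs0[rule_format]
  have cover: "k \<le> n \<Longrightarrow> 0 \<le> \<tau> k \<and> continuous_on {0..\<tau> k} \<gamma> \<and>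
      {0..\<tau> k} \<subseteq> \<tau> ` {..k} \<union> (\<Union>i<k. {\<tau> i<..<\<tau> (Suc i)})" for k
  proof (induction k)
    case 0
    then show ?case by (simp add: t0)
  next
    case (Suc k)
    have lt: "\<tau> k < \<tau> (Suc k)" using arcs Suc.prems by simp
    have c: "continuous_on {\<tau> k..\<tau> (Suc k)} \<gamma>"
      using arcs[of k] Suc.prems unfolding trajectory_arc_def
      by (meson Suc_le_lessD has_vector_derivative_continuous continuous_on_eq_continuous_within)
    have eq: "{0..\<tau> (Suc k)} = {0..\<tau> k} \<union> {\<tau> k..\<tau> (Suc k)}"
      using Suc lt by auto
    have "continuous_on {0..\<tau> (Suc k)} \<gamma>"
      unfolding eq using Suc c by (intro continuous_on_closed_Un) auto
    moreover have "{\<tau> k..\<tau> (Suc k)} \<subseteq> \<tau> ` {..Suc k} \<union> {\<tau> k<..<\<tau> (Suc k)}"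
      by (auto simp: less_le)
    moreover have "0 \<le> \<tau> (Suc k)" "{0..\<tau> k} \<subseteq> \<tau> ` {..k} \<union> (\<Union>i<k. {\<tau> i<..<\<tau> (Suc i)})"
      using Suc lt by auto
    ultimately show ?case
      unfolding eq lessThan_Suc atMost_Suc by blast
  qed
  have contg: "continuous_on {0..T} \<gamma>" using cover[of n] tn by simp
  define v where "v t = vector_derivative \<gamma> (at t)" for t
  have v: "(\<gamma> has_vector_derivative v t) (at t) \<and> v t \<in> filippov X Y (\<gamma> t) \<and>
      v t \<in> {X (\<gamma> t), Y (\<gamma> t)}" if t: "t \<in> {0..T} - \<tau> ` {..n}" for t
  proof -
    obtain i where i: "i < n" "t \<in> {\<tau> i<..<\<tau> (Suc i)}"
      using cover[OF order_refl, unfolded tn] t by blast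
    have at: "at t within {\<tau> i..\<tau> (Suc i)} = at t"
      using i by (intro at_within_interior) auto
    have ti: "t \<in> {\<tau> i..\<tau> (Suc i)}" using i by auto
    from arcs[OF i(1)] ti at consider
      "(\<gamma> has_vector_derivative X (\<gamma> t)) (at t)" "h (\<gamma> t) \<le> 0" |
      "(\<gamma> has_vector_derivative Y (\<gamma> t)) (at t)" "h (\<gamma> t) \<ge> 0"
      unfolding trajectory_arc_def by metis
    then show ?thesis
    proof cases
      case 1
      then have "v t = X (\<gamma> t)" by (simp add: v_def vector_derivative_at)
      with 1 show ?thesis by (simp add: filippov_def)
    next
      case 2
      then have "v t = Y (\<gamma> t)" by (simp add: v_def vector_derivative_at)
      with 2 show ?thesis by (simp add: filippov_def)
    qed
  qed
  have fin: "finite (\<tau> ` {..n})" by simp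
  have ftc: "(v has_integral \<gamma> t - \<gamma> 0) {0..t}" if "t \<in> {0..T}" for t
    using that v by (intro fundamental_theorem_of_calculus_interior_strong[OF fin]
        continuous_on_subset[OF contg]) auto
  have "bounded (X ` \<Gamma> \<union> Y ` \<Gamma>)"
    unfolding im
    by (intro compact_imp_bounded compact_Un compact_continuous_image
        continuous_on_subset[OF cont(1)] continuous_on_subset[OF cont(2)] contg)
      (use sub im in auto)
  then obtain B where B: "\<And>x. x \<in> X ` \<Gamma> \<union> Y ` \<Gamma> \<Longrightarrow> norm x \<le> B"
    unfolding bounded_iff by blast
  define w where "w t = (if t \<in> \<tau> ` {..n} then X (\<gamma> t) else v t)" for t
  have wi: "(w has_integral \<gamma> t - \<gamma> 0) {0..t}" if "t \<in> {0..T}" for t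
    by (rule has_integral_spike_finite[OF fin _ ftc[OF that]]) (auto simp: w_def)
  have "w absolutely_integrable_on {0..T}"
  proof (rule measurable_bounded_by_integrable_imp_absolutely_integrable)
    show "w \<in> borel_measurable (lebesgue_on {0..T})"
      using wi[of T] T by (intro integrable_imp_measurable) auto
    show "(\<lambda>_. B) integrable_on {0..T}" by (rule integrable_const_ivl)
    show "norm (w t) \<le> B" if "t \<in> {0..T}" for t
      using v[of t] that B by (fastforce simp: w_def im)
  qed auto
  moreover have "\<gamma> t = \<gamma> 0 + integral {0..t} w" if "t \<in> {0..T}" for t
    using integral_unique[OF wi[OF that]] by simp
  moreover have "negligible {t \<in> {0..T}. w t \<notin> filippov X Y (\<gamma> t)}"
    by (rule negligible_subset[OF negligible_finite[OF fin]]) (use v in \<open>auto simp: w_def\<close>)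
  ultimately show ?thesis
    unfolding periodic_orbit_def using T im sub cl nc by blast
qed

end

theory Submission
  imports Defs
begin

text \<open>The matrix of \<open>Y\<close> has trace \<open>0\<close>, so \<open>Y\<close> has a quadratic first integral \<open>H\<close>.  A cycle
  meeting the circle in two points consists of a chord parallel to the constant field \<open>c\<close> and an
  arc of \<open>Y\<close> joining its endpoints \<open>q\<close> and \<open>mirror q\<close>, where the mirror is the reflection that
  sends \<open>c\<close> to \<open>- c\<close>.  Since \<open>H\<close> is quadratic, \<open>H q = H (mirror q)\<close> is a linear
  condition on the midpoint of the chord, which lies on the axis orthogonal to \<open>c\<close>.  If the condition
  is nondegenerate it determines the midpoint and therefore the cycle.  Otherwise \<open>Y\<close> is reversible
  with respect to the mirror, and cycles come in continuous families, so none of them is a limit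
  cycle.\<close>

section \<open>Traceless planar linear maps\<close>

text \<open>A return map on the circle would involve the outer travel time, which has no closed
  form. Comparing the form \<open>wedge v (L v)\<close>, with \<open>v = z - p0\<close>, at the two
  ends of the outer arc eliminates that time: for ends \<open>m + y c\<close> and
  \<open>m - y c\<close> the difference is \<open>4 y wedge c (L m)\<close>, and the positive factor
  \<open>y\<close> cancels. Symmetry of \<open>wedge u (L v)\<close> is trace zero, which centers
  and divergence-free saddles share; with \<open>L (L v) = k v\<close> both types run through one
  argument. The coefficient of the midpoint is \<open>wedge c (L (rot c))\<close>. If it vanishes,
  the existence of one cycle still forces \<open>p0\<close> onto the mirror axis, and nearby cycles
  can then be written down explicitly. A second obstacle is that orbits are concatenations with
  arbitrary breakpoints: it must be shown that two circle points leave exactly one chord and one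
  arc.\<close>

definition wedge :: "real^2 \<Rightarrow> real^2 \<Rightarrow> real" where
  "wedge u v = u$1 * v$2 - u$2 * v$1"

lemma wedge_simps:
  "wedge (u + v) w = wedge u w + wedge v w" "wedge u (v + w) = wedge u v + wedge u w"
  "wedge (u - v) w = wedge u w - wedge v w" "wedge u (v - w) = wedge u v - wedge u w"
  "wedge (r *\<^sub>R u) v = r * wedge u v" "wedge u (r *\<^sub>R v) = r * wedge u v"
  "wedge u u = 0"
  by (simp_all add: wedge_def algebra_simps)

lemma wedge_commute: "wedge u v = - wedge v u"
  by (simp add: wedge_def)

definition rot :: "real^2 \<Rightarrow> real^2" where
  "rot u = vector [- u$2, u$1]"

lemma inner_vec2: "(u::real^2) \<bullet> v = u$1 * v$1 + u$2 * v$2"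
  by (simp add: inner_vec_def sum_2)

lemma vec2_eq_iff: "(u::'a^2) = v \<longleftrightarrow> u$1 = v$1 \<and> u$2 = v$2"
  by (simp add: vec_eq_iff forall_2)

lemma h_eq: "h z = z \<bullet> z - 1"
  by (simp add: h_def inner_vec2 power2_eq_square)

text \<open>Eliminating one coordinate of the eigenvector shows that \<open>?P\<close> annihilates
  the other, and one of the two is nonzero.\<close>

lemma eigenvalue_charpoly:
  assumes "l \<in> eigenvalues A"
  shows "l\<^sup>2 - complex_of_real (trace A) * l + complex_of_real (det A) = 0"
proof -
  obtain v :: "complex^2" where v: "v \<noteq> 0" "map_matrix complex_of_real A *v v = l *s v"
    using assms unfolding eigenvalues_def by blast
  let ?a = "complex_of_real (A$1$1)" and ?b = "complex_of_real (A$1$2)"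
  let ?c = "complex_of_real (A$2$1)" and ?d = "complex_of_real (A$2$2)"
  from v(2) have e: "?a * v$1 + ?b * v$2 = l * v$1" "?c * v$1 + ?d * v$2 = l * v$2"
    by (simp_all add: vec2_eq_iff matrix_vector_mult_def sum_2 map_matrix_def)
  let ?P = "l\<^sup>2 - (?a + ?d) * l + (?a * ?d - ?b * ?c)"
  have "?P * v$1 = 0" "?P * v$2 = 0"
    using e by algebra+
  with v(1) have "?P = 0" by (auto simp: vec2_eq_iff)
  then show ?thesis by (simp add: trace_def sum_2 det_2)
qed

text \<open>Cayley-Hamilton for vanishing trace; it confines the flow to the span of
  \<open>u\<close> and \<open>A *v u\<close>.\<close>

lemma traceless_square:
  fixes A :: "real^2^2"
  assumes "trace A = 0"
  shows "A *v (A *v u) = (- det A) *\<^sub>R u"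
proof -
  have d: "A$2$2 = - A$1$1" using assms by (simp add: trace_def sum_2)
  show ?thesis
    by (simp add: vec2_eq_iff matrix_vector_mult_def sum_2 det_2 d algebra_simps)
qed

text \<open>A traceless matrix is infinitesimally area preserving,
  \<open>wedge (A u) v + wedge u (A v) = 0\<close>. The resulting symmetric form supplies the
  Hamiltonian.\<close>

lemma traceless_wedge_sym:
  fixes A :: "real^2^2"
  assumes "trace A = 0"
  shows "wedge u (A *v v) = wedge v (A *v u)"
proof -
  have d: "A$2$2 = - A$1$1" using assms by (simp add: trace_def sum_2)
  show ?thesis
    by (simp add: wedge_def matrix_vector_mult_def sum_2 d algebra_simps)
qed

text \<open>At the root \<open>Complex 0 w\<close> the imaginary part of the characteristic equation
  gives the trace, and the real part gives \<open>det A = w * w\<close>.\<close>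

lemma linear_center_matrix:
  assumes "linear_center U Y"
  obtains A p where "\<forall>z\<in>U. Y z = A *v (z - p)" "trace A = 0" "det A \<noteq> 0"
proof -
  obtain A b p w where Y: "\<forall>z\<in>U. Y z = A *v z + b" and p: "A *v p + b = 0" and "w \<noteq> 0"
    and ev: "eigenvalues A = {Complex 0 w, Complex 0 (- w)}"
    using assms unfolding linear_center_def by blast
  have "(Complex 0 w)\<^sup>2 - complex_of_real (trace A) * Complex 0 w + complex_of_real (det A) = 0"
    by (rule eigenvalue_charpoly) (simp add: ev)
  with \<open>w \<noteq> 0\<close> have "trace A = 0" "det A \<noteq> 0"
    by (auto simp: complex_eq_iff power2_eq_square)
  moreover have "b = - (A *v p)" using p by (simp add: eq_neg_iff_add_eq_0 add.commute)
  ultimately show ?thesis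
    using Y by (intro that[of A p]) (auto simp: matrix_vector_mult_diff_distrib)
qed

text \<open>Here the trace is the divergence, read off at \<open>z0\<close>; the root
  \<open>r\<close> then gives \<open>det A = - (r * r)\<close>.\<close>

lemma linear_saddle_matrix:
  assumes "linear_saddle U Y" "open U" "z0 \<in> U" "\<forall>z\<in>U. divergence Y z = 0"
  obtains A p where "\<forall>z\<in>U. Y z = A *v (z - p)" "trace A = 0" "det A \<noteq> 0"
proof -
  obtain A b p and r s :: real where Y: "\<forall>z\<in>U. Y z = A *v z + b" and p: "A *v p + b = 0"
    and "r < 0" and ev: "eigenvalues A = {complex_of_real r, complex_of_real s}"
    using assms(1) unfolding linear_saddle_def by blast
  have tr: "trace A = 0" using divergence_affine[OF assms(2,3) Y] assms(3,4) by simp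
  have "(complex_of_real r)\<^sup>2 - complex_of_real (trace A) * complex_of_real r + complex_of_real (det A) = 0"
    by (rule eigenvalue_charpoly) (simp add: ev)
  then have "complex_of_real (r\<^sup>2 + det A) = 0" by (simp add: tr)
  then have "r\<^sup>2 + det A = 0" by (simp only: of_real_eq_0_iff)
  with \<open>r < 0\<close> have "det A \<noteq> 0" by auto
  moreover have "b = - (A *v p)" using p by (simp add: eq_neg_iff_add_eq_0 add.commute)
  ultimately show ?thesis
    using Y tr by (intro that[of A p]) (auto simp: matrix_vector_mult_diff_distrib)
qed

text \<open>\<open>Cf k\<close> and \<open>Sf k\<close> are the solutions of \<open>f'' = k f\<close> with initial data \<open>(1, 0)\<close> and
  \<open>(0, 1)\<close>; the definitions are meaningful only for \<open>k \<noteq> 0\<close>.\<close>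

definition Cf :: "real \<Rightarrow> real \<Rightarrow> real" where
  "Cf k t = (if k > 0 then cosh (sqrt k * t) else cos (sqrt (- k) * t))"

definition Sf :: "real \<Rightarrow> real \<Rightarrow> real" where
  "Sf k t = (if k > 0 then sinh (sqrt k * t) / sqrt k else sin (sqrt (- k) * t) / sqrt (- k))"

lemma Cf_Sf_0 [simp]: "Cf k 0 = 1" "Sf k 0 = 0"
  by (simp_all add: Cf_def Sf_def)

context
  fixes k :: real
  assumes k: "k \<noteq> 0"
begin

lemma Cf_deriv: "(Cf k has_real_derivative k * Sf k t) (at t within A)"
proof (cases "k > 0")
  case True
  then have "((\<lambda>t. cosh (sqrt k * t)) has_real_derivative k * (sinh (sqrt k * t) / sqrt k)) (at t within A)"
    by (auto intro!: derivative_eq_intros simp: field_simps)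
  then show ?thesis using True by (simp add: Cf_def[abs_def] Sf_def)
next
  case False
  define r where "r = sqrt (- k)"
  have r: "r \<noteq> 0" "k = - (r * r)" using k False by (simp_all add: r_def flip: real_sqrt_minus)
  have "((\<lambda>t. cos (r * t)) has_real_derivative k * (sin (r * t) / r)) (at t within A)"
    using r by (auto intro!: derivative_eq_intros simp: field_simps)
  then show ?thesis using False by (simp add: Cf_def[abs_def] Sf_def r_def)
qed

lemma Sf_deriv: "(Sf k has_real_derivative Cf k t) (at t within A)"
proof (cases "k > 0")
  case True
  then have "((\<lambda>t. sinh (sqrt k * t) / sqrt k) has_real_derivative cosh (sqrt k * t)) (at t within A)"
    by (auto intro!: derivative_eq_intros simp: field_simps)
  then show ?thesis using True by (simp add: Sf_def[abs_def] Cf_def)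
next
  case False
  define r where "r = sqrt (- k)"
  have r: "r \<noteq> 0" using k False by (simp add: r_def)
  have "((\<lambda>t. sin (r * t) / r) has_real_derivative cos (r * t)) (at t within A)"
    using r by (auto intro!: derivative_eq_intros simp: field_simps)
  then show ?thesis using False by (simp add: Sf_def[abs_def] Cf_def r_def)
qed

lemma Cf_diff: "Cf k (s - t) = Cf k s * Cf k t - k * (Sf k s * Sf k t)"
proof (cases "k > 0")
  case True
  then show ?thesis by (simp add: Cf_def Sf_def right_diff_distrib cosh_diff)
next
  case False
  with k have "sqrt (- k) * sqrt (- k) = - k" by simp
  then show ?thesis using k False
    by (simp add: Cf_def Sf_def right_diff_distrib cos_diff del: real_sqrt_mult_self)
qed

lemma Sf_diff: "Sf k (s - t) = Sf k s * Cf k t - Cf k s * Sf k t"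
  by (simp add: Cf_def Sf_def right_diff_distrib sin_diff sinh_diff diff_divide_distrib)

lemma Cf_Sf_square: "Cf k t * Cf k t - k * (Sf k t * Sf k t) = 1"
  using Cf_diff[of t t] by simp

end

section \<open>Crossing periodic orbits as periodic curves on the line\<close>

text \<open>Both ends of \<open>{0..T}\<close> are covered, so that a closed arc ending at time
  \<open>T\<close> can be translated as a whole.\<close>

lemma periodic_extension:
  fixes \<gamma> :: "real \<Rightarrow> 'a"
  assumes "T > 0" "\<gamma> T = \<gamma> 0"
  obtains g where "\<And>(m::int) t. t \<in> {0..T} \<Longrightarrow> g (t + of_int m * T) = \<gamma> t"
proof
  fix m :: int and t assume t: "t \<in> {0..T}"
  show "(\<lambda>t. \<gamma> (t - of_int \<lfloor>t / T\<rfloor> * T)) (t + of_int m * T) = \<gamma> t"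
  proof (cases "t = T")
    case True
    have "(T + of_int m * T) / T = of_int (m + 1)"
      using assms(1) by (simp add: field_simps)
    then have "\<lfloor>(T + of_int m * T) / T\<rfloor> = m + 1" by (simp only: floor_of_int)
    then show ?thesis using True assms by (simp add: algebra_simps)
  next
    case False
    then have "\<lfloor>(t + of_int m * T) / T\<rfloor> = m"
      using t assms(1) by (intro floor_unique) (auto simp: field_simps)
    then show ?thesis by simp
  qed
qed

definition pw_arc :: "vfield \<Rightarrow> vfield \<Rightarrow> (real \<Rightarrow> real^2) \<Rightarrow> real \<Rightarrow> real \<Rightarrow> bool" where
  "pw_arc X Y \<gamma> a b \<longleftrightarrow> a < b \<and>
     (trajectory_arc X \<gamma> a b \<and> (\<forall>t\<in>{a..b}. h (\<gamma> t) \<le> 0) \<or>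
      trajectory_arc Y \<gamma> a b \<and> (\<forall>t\<in>{a..b}. h (\<gamma> t) \<ge> 0))"

lemma trajectory_arc_subset:
  assumes "trajectory_arc F \<gamma> a b" "a \<le> a'" "b' \<le> b"
  shows "trajectory_arc F \<gamma> a' b'"
  unfolding trajectory_arc_def
proof
  fix t assume "t \<in> {a'..b'}"
  then have "(\<gamma> has_vector_derivative F (\<gamma> t)) (at t within {a..b})"
    using assms unfolding trajectory_arc_def by auto
  then show "(\<gamma> has_vector_derivative F (\<gamma> t)) (at t within {a'..b'})"
    by (rule has_vector_derivative_within_subset) (use assms in auto)
qed

lemma pw_arc_subset:
  assumes "pw_arc X Y \<gamma> a b" "a \<le> a'" "a' < b'" "b' \<le> b"
  shows "pw_arc X Y \<gamma> a' b'"
  using assms trajectory_arc_subset[OF _ assms(2,4)] unfolding pw_arc_def by auto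

lemma trajectory_arc_shift:
  assumes "trajectory_arc F \<gamma> a b" "\<And>t. t \<in> {a..b} \<Longrightarrow> g (t + r) = \<gamma> t"
  shows "trajectory_arc F g (a + r) (b + r)"
  unfolding trajectory_arc_def
proof
  fix t assume t: "t \<in> {a + r..b + r}"
  have im: "(\<lambda>x. x - r) ` {a + r..b + r} = {a..b}"
    by (auto simp: image_iff intro!: bexI[of _ "_ + r"])
  have "(\<gamma> has_vector_derivative F (\<gamma> (t - r))) (at (t - r) within (\<lambda>x. x - r) ` {a + r..b + r})"
    using assms(1) t unfolding im trajectory_arc_def by auto
  moreover have "((\<lambda>x. x - r) has_vector_derivative 1) (at t within {a + r..b + r})"
    by (auto intro!: derivative_eq_intros)
  ultimately have "((\<gamma> \<circ> (\<lambda>x. x - r)) has_vector_derivative F (\<gamma> (t - r))) (at t within {a + r..b + r})"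
    using vector_diff_chain_within by fastforce
  then have "(g has_vector_derivative F (\<gamma> (t - r))) (at t within {a + r..b + r})"
    by (rule has_vector_derivative_transform[OF t, rotated]) (use assms(2)[of "_ - r"] in auto)
  then show "(g has_vector_derivative F (g t)) (at t within {a + r..b + r})"
    using assms(2)[of "t - r"] t by auto
qed

lemma pw_arc_shift:
  assumes "pw_arc X Y \<gamma> a b" and g: "\<And>t. t \<in> {a..b} \<Longrightarrow> g (t + r) = \<gamma> t"
  shows "pw_arc X Y g (a + r) (b + r)"
proof -
  have "g t = \<gamma> (t - r)" if "t \<in> {a + r..b + r}" for t
    using g[of "t - r"] that by auto
  then show ?thesis
    using assms(1) trajectory_arc_shift[of X \<gamma> a b g r] trajectory_arc_shift[of Y \<gamma> a b g r] g
    unfolding pw_arc_def by auto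
qed

text \<open>The least index whose node exceeds \<open>t\<close> has a predecessor because
  \<open>\<tau> 0\<close> does not exceed \<open>t\<close>.\<close>

lemma partition_cell:
  fixes \<tau> :: "nat \<Rightarrow> real"
  assumes "\<tau> 0 \<le> t" "t < \<tau> n"
  obtains i where "i < n" "\<tau> i \<le> t" "t < \<tau> (Suc i)"
proof -
  define j where "j = (LEAST j. t < \<tau> j)"
  have j: "t < \<tau> j" "j \<le> n" unfolding j_def using assms(2) by (auto intro: LeastI Least_le)
  with assms(1) obtain i where i: "j = Suc i" by (cases j) auto
  then have "\<not> t < \<tau> i" using not_less_Least[of i "\<lambda>j. t < \<tau> j"] by (simp add: j_def)
  with i j show ?thesis by (intro that[of i]) auto
qed

text \<open>Cells open on the left: they give an arc reaching \<open>t\<close> from the left even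
  when \<open>t\<close> is a node.\<close>

lemma partition_cell':
  fixes \<tau> :: "nat \<Rightarrow> real"
  assumes "\<tau> 0 < t" "t \<le> \<tau> n"
  obtains i where "i < n" "\<tau> i < t" "t \<le> \<tau> (Suc i)"
proof -
  define j where "j = (LEAST j. t \<le> \<tau> j)"
  have j: "t \<le> \<tau> j" "j \<le> n" unfolding j_def using assms(2) by (auto intro: LeastI Least_le)
  with assms(1) obtain i where i: "j = Suc i" by (cases j) auto
  then have "\<not> t \<le> \<tau> i" using not_less_Least[of i "\<lambda>j. t \<le> \<tau> j"] by (simp add: j_def)
  with i j show ?thesis by (intro that[of i]) auto
qed

text \<open>The partition and the starting time disappear: every time on the line has an arc on
  either side, possibly of different fields. One can then follow the curve from any circle time in
  both directions.\<close>

lemma crossing_periodic_orbit_extension: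
  assumes "crossing_periodic_orbit U X Y \<Gamma>"
  obtains g T where "T > 0" "range g = \<Gamma>" "\<And>t. g (t + T) = g t"
    "\<And>t. \<exists>e>0. pw_arc X Y g t (t + e)" "\<And>t. \<exists>e>0. pw_arc X Y g (t - e) t"
proof -
  obtain \<gamma> T n \<tau> where T: "T > 0" and im: "\<Gamma> = \<gamma> ` {0..T}"
    and cl: "\<gamma> T = \<gamma> 0" and t0: "\<tau> 0 = 0" and tn: "\<tau> n = T"
    and arcs: "\<forall>i<n. \<tau> i < \<tau> (Suc i) \<and>
           (trajectory_arc X \<gamma> (\<tau> i) (\<tau> (Suc i)) \<and> (\<forall>t\<in>{\<tau> i..\<tau> (Suc i)}. h (\<gamma> t) \<le> 0) \<or>
            trajectory_arc Y \<gamma> (\<tau> i) (\<tau> (Suc i)) \<and> (\<forall>t\<in>{\<tau> i..\<tau> (Suc i)}. h (\<gamma> t) \<ge> 0))"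
    using assms unfolding crossing_periodic_orbit_def
    by (elim exE conjE) (rule that; assumption)
  then have arcs: "pw_arc X Y \<gamma> (\<tau> i) (\<tau> (Suc i))" if "i < n" for i
    using that unfolding pw_arc_def by blast
  have mono: "i \<le> j \<Longrightarrow> j \<le> n \<Longrightarrow> \<tau> i \<le> \<tau> j" for i j
  proof (induction j rule: dec_induct)
    case (step j)
    then show ?case using arcs[of j] unfolding pw_arc_def by simp
  qed simp
  obtain g where g: "\<And>(m::int) t. t \<in> {0..T} \<Longrightarrow> g (t + of_int m * T) = \<gamma> t"
    using periodic_extension[OF T cl] by blast
  have dec: "\<exists>(m::int) s. t = s + of_int m * T \<and> 0 \<le> s \<and> s < T" for t
    using T floor_divide_lower[OF T, of t] floor_divide_upper[OF T, of t]
    by (intro exI[of _ "\<lfloor>t / T\<rfloor>"] exI[of _ "t - of_int \<lfloor>t / T\<rfloor> * T"]) (auto simp: algebra_simps)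
  \<comment> \<open>To the left of a multiple of \<open>T\<close> lies the last arc of the preceding
    period; hence \<open>m - 1\<close> and \<open>s = T\<close> when the remainder is 0.\<close>
  have dec': "\<exists>(m::int) s. t = s + of_int m * T \<and> 0 < s \<and> s \<le> T" for t
  proof -
    obtain m :: int and s where "t = s + of_int m * T" "0 \<le> s" "s < T" using dec by blast
    then show ?thesis using T
      by (cases "s = 0")
        (rule exI[of _ "m - 1"], rule exI[of _ T], simp add: algebra_simps,
         rule exI[of _ m], rule exI[of _ s], simp)
  qed
  show ?thesis
  proof (rule that[OF T])
    show "g (t + T) = g t" for t
    proof -
      obtain m :: int and s where "t = s + of_int m * T" "s \<in> {0..T}"
        using dec[of t] by fastforce
      then show ?thesis using g[of s m] g[of s "m + 1"] by (simp add: algebra_simps)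
    qed
    show "range g = \<Gamma>"
    proof
      show "range g \<subseteq> \<Gamma>"
      proof clarify
        fix t
        obtain m :: int and s where "t = s + of_int m * T" "s \<in> {0..T}"
          using dec[of t] by fastforce
        then show "g t \<in> \<Gamma>" using g[of s m] by (auto simp: im)
      qed
      show "\<Gamma> \<subseteq> range g" using g[of _ 0] by (auto simp: im) (metis rangeI)
    qed
    show "\<exists>e>0. pw_arc X Y g t (t + e)" for t
    proof -
      obtain m :: int and s where s: "t = s + of_int m * T" "0 \<le> s" "s < T" using dec by blast
      obtain i where i: "i < n" "\<tau> i \<le> s" "s < \<tau> (Suc i)"
        using partition_cell[of \<tau> s n] s by (auto simp: t0 tn)
      have "\<tau> (Suc i) \<le> T" using mono[of "Suc i" n] i tn by simp
      then have "pw_arc X Y g (s + of_int m * T) (\<tau> (Suc i) + of_int m * T)"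
        using s by (intro pw_arc_shift[OF pw_arc_subset[OF arcs[OF i(1)]] g] i) auto
      then show ?thesis using s i by (intro exI[of _ "\<tau> (Suc i) - s"]) (auto simp: algebra_simps)
    qed
    show "\<exists>e>0. pw_arc X Y g (t - e) t" for t
    proof -
      obtain m :: int and s where s: "t = s + of_int m * T" "0 < s" "s \<le> T" using dec' by blast
      obtain i where i: "i < n" "\<tau> i < s" "s \<le> \<tau> (Suc i)"
        using partition_cell'[of \<tau> s n] s by (auto simp: t0 tn)
      have "0 \<le> \<tau> i" using mono[of 0 i] i t0 by simp
      then have "pw_arc X Y g (\<tau> i + of_int m * T) (s + of_int m * T)"
        using s by (intro pw_arc_shift[OF pw_arc_subset[OF arcs[OF i(1)]] g] i) auto
      then show ?thesis using s i by (intro exI[of _ "s - \<tau> i"]) (auto simp: algebra_simps)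
    qed
  qed
qed

text \<open>Off the circle the arcs on both sides follow the same field, so the nodes of a partition
  cause no corners there.\<close>

lemma has_vector_derivative_left_right:
  fixes g :: "real \<Rightarrow> 'a::real_normed_vector"
  assumes "(g has_vector_derivative v) (at t within {t..t + e})" "e > 0"
    and "(g has_vector_derivative v) (at t within {t - e'..t})" "e' > 0"
  shows "(g has_vector_derivative v) (at t)"
proof -
  have "(g has_vector_derivative v) (at t within {t - e'..t} \<union> {t..t + e})"
    using assms unfolding has_vector_derivative_def has_derivative_within
    by (auto intro: Lim_Un)
  moreover have "{t - e'..t} \<union> {t..t + e} = {t - e'..t + e}"
    using assms(2,4) by auto
  then have "t \<in> interior ({t - e'..t} \<union> {t..t + e})"
    using assms(2,4) by simp
  ultimately show ?thesis by (metis at_within_interior)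
qed

lemma isCont_left_right:
  fixes g :: "real \<Rightarrow> 'a::metric_space"
  assumes "continuous (at t within {t..t + e}) g" "e > 0"
    and "continuous (at t within {t - e'..t}) g" "e' > 0"
  shows "isCont g t"
proof -
  have "continuous (at t within {t - e'..t} \<union> {t..t + e}) g"
    using assms unfolding continuous_within by (auto intro: Lim_Un)
  moreover have "{t - e'..t} \<union> {t..t + e} = {t - e'..t + e}"
    using assms(2,4) by auto
  then have "t \<in> interior ({t - e'..t} \<union> {t..t + e})"
    using assms(2,4) by simp
  ultimately show ?thesis by (metis at_within_interior)
qed

lemma h_comp_deriv:
  assumes "(g has_vector_derivative v) (at t within S)"
  shows "((\<lambda>s. h (g s)) has_real_derivative 2 * (v \<bullet> g t)) (at t within S)"
proof -
  have g: "(g has_derivative (\<lambda>x. x *\<^sub>R v)) (at t within S)"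
    using assms by (simp add: has_vector_derivative_def)
  show ?thesis
    unfolding h_eq has_field_derivative_def
    by (rule derivative_eq_intros g refl)+ (simp add: inner_commute algebra_simps fun_eq_iff)
qed

text \<open>The zeros in \<open>{t..z}\<close> form a compact set, so there is a first one; a
  nonpositive value before it would produce an earlier zero.\<close>

lemma next_zero:
  fixes f :: "real \<Rightarrow> real"
  assumes c: "continuous_on UNIV f" and "f t > 0" "f z = 0" "t < z"
  obtains b where "t < b" "b \<le> z" "f b = 0" "\<And>s. t \<le> s \<Longrightarrow> s < b \<Longrightarrow> f s > 0"
proof -
  let ?Z = "{t..z} \<inter> f -` {0}"
  have "closed (f -` {0})" using c by (intro continuous_closed_vimage) (auto simp: continuous_on_eq_continuous_at)
  then have "compact ?Z" by (intro compact_Int_closed) auto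
  moreover have "z \<in> ?Z" using assms by simp
  ultimately obtain b where b: "b \<in> ?Z" "\<And>s. s \<in> ?Z \<Longrightarrow> b \<le> s"
    using compact_attains_inf[of ?Z] by (metis emptyE)
  show ?thesis
  proof
    show "b \<le> z" "f b = 0" using b(1) by auto
    show "t < b" using b(1) assms(2) by (cases "t = b") auto
    fix s assume s: "t \<le> s" "s < b"
    show "f s > 0"
    proof (rule ccontr)
      assume "\<not> f s > 0"
      then obtain x where "t \<le> x" "x \<le> s" "f x = 0"
        using IVT2'[of f s 0 t] s assms(2) continuous_on_subset[OF c] by (auto simp: not_less)
      then show False using b(2)[of x] s b(1) by auto
    qed
  qed
qed

lemma last_zero:
  fixes f :: "real \<Rightarrow> real"
  assumes c: "continuous_on UNIV f" and "f t > 0" "f z = 0" "z < t"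
  obtains a where "z \<le> a" "a < t" "f a = 0" "\<And>s. a < s \<Longrightarrow> s \<le> t \<Longrightarrow> f s > 0"
proof -
  have "continuous_on UNIV (\<lambda>s. f (- s))"
    by (intro continuous_on_compose2[OF c] continuous_intros) auto
  from next_zero[OF this, of "- t" "- z"] assms obtain b where
    b: "- t < b" "b \<le> - z" "f (- b) = 0" "\<And>s. - t \<le> s \<Longrightarrow> s < b \<Longrightarrow> f (- s) > 0"
    by auto
  show ?thesis
    using b(1-3) b(4)[of "- _"] by (intro that[of "- b"]) auto
qed

section \<open>The two pieces of the vector field\<close>

text \<open>The last three assumptions encode that \<open>L\<close> has trace \<open>0\<close> and determinant \<open>- k \<noteq> 0\<close>;
  \<open>wedge (z - p0) (L (z - p0))\<close> is the Hamiltonian of \<open>Y\<close>, up to a factor.\<close>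

locale disc_flow =
  fixes U :: "(real^2) set" and X Y L :: "real^2 \<Rightarrow> real^2" and c p0 :: "real^2" and k :: real
  assumes open_U: "open U"
    and X: "\<And>z. z \<in> U \<Longrightarrow> X z = c"
    and Y: "\<And>z. z \<in> U \<Longrightarrow> Y z = L (z - p0)"
    and lin: "linear L"
    and LL: "\<And>v. L (L v) = k *\<^sub>R v"
    and k: "k \<noteq> 0"
    and wedge_sym: "\<And>u v. wedge u (L v) = wedge v (L u)"
begin

text \<open>The exponential of \<open>t L\<close> applied to \<open>u\<close>; its series collapses
  to two terms because \<open>L (L v) = k v\<close>.\<close>

definition flow :: "real \<Rightarrow> real^2 \<Rightarrow> real^2" where
  "flow t u = Cf k t *\<^sub>R u + Sf k t *\<^sub>R L u"

lemma L_simps: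
  "L (u + v) = L u + L v" "L (u - v) = L u - L v" "L (r *\<^sub>R v) = r *\<^sub>R L v" "L (- u) = - L u"
  using lin by (simp_all add: linear_add linear_diff linear_cmul linear_neg)

lemma L_flow: "L (flow t u) = Cf k t *\<^sub>R L u + (k * Sf k t) *\<^sub>R u"
  by (simp add: flow_def L_simps LL mult.commute)

lemma flow_deriv: "((\<lambda>t. flow t u) has_vector_derivative L (flow t u)) (at t within A)"
  unfolding L_flow unfolding flow_def
  using has_vector_derivative_add[OF has_vector_derivative_scaleR[OF Cf_deriv[OF k] has_vector_derivative_const[of u]]
      has_vector_derivative_scaleR[OF Sf_deriv[OF k] has_vector_derivative_const[of "L u"]]]
  by (simp add: add.commute)

lemma flow_0 [simp]: "flow 0 u = u"
  by (simp add: flow_def)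

text \<open>Group law of the exponential, with
  \<open>exp (- t L) = Cf k t - Sf k t L\<close>.\<close>

lemma flow_diff: "flow (s - t) u = Cf k t *\<^sub>R flow s u - Sf k t *\<^sub>R L (flow s u)"
  by (simp add: L_flow) (simp add: flow_def Cf_diff[OF k] Sf_diff[OF k] algebra_simps)

lemma wedge_flow: "wedge (flow t u) (L (flow t u)) = wedge u (L u)"
proof -
  have "wedge (flow t u) (L (flow t u)) = (Cf k t * Cf k t - k * (Sf k t * Sf k t)) * wedge u (L u)"
    unfolding L_flow unfolding flow_def
    by (simp add: wedge_simps wedge_commute[of "L u" u] algebra_simps)
  then show ?thesis by (simp add: Cf_Sf_square[OF k])
qed

text \<open>Only interior derivatives are assumed, since an excursion starts and ends on the circle,
  where the curve may have a corner.\<close>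

lemma flow_unique:
  assumes cont: "continuous_on {a..b} g"
    and der: "\<And>s. a < s \<Longrightarrow> s < b \<Longrightarrow> (g has_vector_derivative L (g s - p0)) (at s)"
    and x: "x \<in> {a..b}"
  shows "g x = p0 + flow (x - a) (g a - p0)"
proof -
  have bl: "bounded_linear L" using lin by (rule linear_linear[THEN iffD2])
  \<comment> \<open>The curve pulled back by the inverse flow,
    \<open>exp (- (s - a) L) (g s - p0)\<close>; uniqueness amounts to its being constant.\<close>
  define m where "m s = Cf k (s - a) *\<^sub>R (g s - p0) - Sf k (s - a) *\<^sub>R L (g s - p0)" for s
  have shift: "((\<lambda>s. s - a) has_real_derivative 1) (at s within A)" for s A
    by (auto intro!: derivative_eq_intros)
  have C: "((\<lambda>s. Cf k (s - a)) has_real_derivative k * Sf k (s - a)) (at s within A)" for s A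
    using DERIV_chain2[OF Cf_deriv[OF k] shift] by simp
  have S: "((\<lambda>s. Sf k (s - a)) has_real_derivative Cf k (s - a)) (at s within A)" for s A
    using DERIV_chain2[OF Sf_deriv[OF k] shift] by simp
  have "m x = m a"
  proof (rule has_derivative_zero_unique_strong_interval[of "{a, b}" a b m "m a"])
    show "continuous_on {a..b} m"
      unfolding m_def
      by (intro continuous_intros cont DERIV_continuous_on[OF C] DERIV_continuous_on[OF S]
          bounded_linear.continuous_on[OF bl])
    fix s assume s: "s \<in> {a..b} - {a, b}"
    then have "(g has_vector_derivative L (g s - p0)) (at s within {a..b})"
      by (auto intro: has_vector_derivative_at_within[OF der])
    then have g: "((\<lambda>s. g s - p0) has_vector_derivative L (g s - p0)) (at s within {a..b})"
      using has_vector_derivative_diff[OF _ has_vector_derivative_const[of p0]] by fastforce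
    have "((\<lambda>s. L (g s - p0)) has_vector_derivative L (L (g s - p0))) (at s within {a..b})"
      by (rule bounded_linear.has_vector_derivative[OF bl g])
    then have "(m has_vector_derivative 0) (at s within {a..b})"
      unfolding m_def
      using has_vector_derivative_diff[OF has_vector_derivative_scaleR[OF C g]
          has_vector_derivative_scaleR[OF S]] by (fastforce simp: LL algebra_simps)
    then show "(m has_derivative (\<lambda>h. 0)) (at s within {a..b})"
      by (simp add: has_vector_derivative_def)
  qed (use x in auto)
  then have "flow (x - a) (m x) = flow (x - a) (g a - p0)" by (simp add: m_def)
  moreover have "flow (x - a) (m x) = (Cf k (x-a) * Cf k (x-a) - k * (Sf k (x-a) * Sf k (x-a))) *\<^sub>R (g x - p0)"
    unfolding flow_def m_def by (simp add: L_simps LL algebra_simps)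
  ultimately have "g x - p0 = flow (x - a) (g a - p0)" by (simp add: Cf_Sf_square[OF k])
  then show ?thesis by (metis add.commute diff_add_cancel)
qed

lemma line_unique:
  assumes cont: "continuous_on {a..b} g"
    and der: "\<And>s. a < s \<Longrightarrow> s < b \<Longrightarrow> (g has_vector_derivative c) (at s)"
    and x: "x \<in> {a..b}"
  shows "g x = g a + (x - a) *\<^sub>R c"
proof -
  have "g x - x *\<^sub>R c = g a - a *\<^sub>R c"
  proof (rule has_derivative_zero_unique_strong_interval[of "{a, b}" a b "\<lambda>s. g s - s *\<^sub>R c"])
    show "continuous_on {a..b} (\<lambda>s. g s - s *\<^sub>R c)"
      by (intro continuous_intros cont)
    fix s assume s: "s \<in> {a..b} - {a, b}"
    then have g: "(g has_vector_derivative c) (at s within {a..b})"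
      by (auto intro: has_vector_derivative_at_within[OF der])
    have "((\<lambda>s. g s - s *\<^sub>R c) has_vector_derivative 0) (at s within {a..b})"
      using has_vector_derivative_diff[OF g has_vector_derivative_scaleR[OF DERIV_ident has_vector_derivative_const[of c]]]
      by simp
    then show "((\<lambda>s. g s - s *\<^sub>R c) has_derivative (\<lambda>h. 0)) (at s within {a..b})"
      by (simp add: has_vector_derivative_def)
  qed (use x in auto)
  then show ?thesis by (simp add: algebra_simps)
qed

definition mirror :: "real^2 \<Rightarrow> real^2" where
  "mirror z = z - (2 * (z \<bullet> c) / (c \<bullet> c)) *\<^sub>R c"

text \<open>\<open>q\<close> is the point where the orbit leaves the disc and \<open>t\<close> is the time it then spends outside,
  so that \<open>mirror q\<close> is the point of re-entry.\<close>

definition cyc :: "real^2 \<Rightarrow> real \<Rightarrow> bool" where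
  "cyc q t \<longleftrightarrow> q \<bullet> q = 1 \<and> q \<bullet> c > 0 \<and> L (q - p0) \<bullet> q > 0 \<and> t > 0 \<and>
     p0 + flow t (q - p0) = mirror q \<and> (\<forall>s\<in>{0<..<t}. h (p0 + flow s (q - p0)) > 0)"

definition cyc_set :: "real^2 \<Rightarrow> real \<Rightarrow> (real^2) set" where
  "cyc_set q t = closed_segment (mirror q) q \<union> (\<lambda>s. p0 + flow s (q - p0)) ` {0..t}"

text \<open>Since \<open>mirror q\<close> is on the circle, \<open>t\<close> is the first return
  time: a shorter duration would put a circle point in the interior of the longer arc.\<close>

lemma cyc_time_unique:
  assumes "cyc q t" "cyc q t'" shows "t = t'"
proof -
  have False if "cyc q t" "cyc q t'" "t < t'" for t t'
  proof -
    have q: "q \<bullet> q = 1" "q \<bullet> c > 0" using that by (auto simp: cyc_def)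
    then have "c \<noteq> 0" by auto
    then have "mirror q \<bullet> mirror q = 1"
      using q(1) by (simp add: mirror_def inner_diff inner_commute field_simps)
    then have "h (p0 + flow t (q - p0)) = 0" using that(1) by (simp add: cyc_def h_eq)
    moreover have "t \<in> {0<..<t'}" using that by (auto simp: cyc_def)
    then have "h (p0 + flow t (q - p0)) > 0" using that(2) unfolding cyc_def by blast
    ultimately show False by simp
  qed
  with assms show ?thesis by (metis linorder_neqE_linordered_idom)
qed

text \<open>The form is conserved along the arc, whose ends relative to \<open>p0\<close> are
  \<open>?m + y c\<close> and \<open>?m - y c\<close>. The even terms cancel and the cross terms add
  up by \<open>wedge_sym\<close>.\<close>

lemma cyc_wedge:
  assumes "cyc q t"
  shows "wedge c (L (q - ((q \<bullet> c) / (c \<bullet> c)) *\<^sub>R c - p0)) = 0"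
proof -
  define y where "y = (q \<bullet> c) / (c \<bullet> c)"
  have qc: "q \<bullet> c > 0" using assms by (auto simp: cyc_def)
  then have "c \<noteq> 0" by auto
  with qc have "y > 0" by (simp add: y_def)
  let ?m = "q - y *\<^sub>R c - p0"
  have "mirror q - p0 = flow t (q - p0)" using assms by (auto simp: cyc_def algebra_simps)
  then have "wedge (mirror q - p0) (L (mirror q - p0)) = wedge (q - p0) (L (q - p0))"
    by (simp add: wedge_flow)
  moreover have "mirror q - p0 = ?m - y *\<^sub>R c" "q - p0 = ?m + y *\<^sub>R c"
    by (simp_all add: mirror_def y_def algebra_simps flip: scaleR_2)
  ultimately have "4 * y * wedge c (L ?m) = 0"
    using wedge_sym[of ?m c] by (simp only: L_simps wedge_simps) (simp add: algebra_simps)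
  with \<open>y > 0\<close> have "wedge c (L ?m) = 0" by simp
  then show ?thesis by (simp only: y_def)
qed

end

section \<open>Cycles through two points of the circle\<close>

context disc_flow
begin

text \<open>A line of direction \<open>c\<close> meets a circle about the origin in at most two
  points, and the reflection exchanges them.\<close>

lemma mirror_eqI:
  assumes "p \<bullet> p = q \<bullet> q" "q = p + r *\<^sub>R c" "r > 0" "c \<noteq> 0"
  shows "p = mirror q"
proof -
  have "r * (2 * (q \<bullet> c) - r * (c \<bullet> c)) = q \<bullet> q - p \<bullet> p"
    by (simp add: assms(2) inner_add inner_commute algebra_simps)
  then have "2 * (q \<bullet> c) = r * (c \<bullet> c)" using assms(1,3) by simp
  then have "2 * (q \<bullet> c) / (c \<bullet> c) = r" using assms(4) by simp
  then show ?thesis by (simp add: mirror_def assms(2))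
qed

text \<open>At a circle time the sign of \<open>g t \<bullet> c\<close> is, by the crossing
  condition, the sign of both one-sided derivatives of \<open>h\<close>, so the curve changes sides:
  outwards if positive, inwards if negative. Periodicity brings each excursion back to the circle,
  so exits and entries alternate. Two circle points mean one exit point and one entry point, and by
  uniqueness of solutions every excursion repeats the same arc or the same chord.\<close>

lemma orbit_structure:
  assumes cpo: "crossing_periodic_orbit U X Y \<Gamma>" and card: "card (\<Gamma> \<inter> S1) = 2"
  obtains q t where "cyc q t" "\<Gamma> = cyc_set q t"
proof -
  have "\<Gamma> \<subseteq> U \<and> \<Gamma> \<inter> S1 \<subseteq> crossing_region X Y"
    using cpo unfolding crossing_periodic_orbit_def by (elim exE conjE) (rule conjI; assumption)
  then have \<Gamma>: "\<Gamma> \<subseteq> U" "\<Gamma> \<inter> S1 \<subseteq> crossing_region X Y" by simp_all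
  obtain g T where T: "T > 0" and g: "range g = \<Gamma>" "\<And>t. g (t + T) = g t"
    and right: "\<And>t. \<exists>e>0. pw_arc X Y g t (t + e)" and left: "\<And>t. \<exists>e>0. pw_arc X Y g (t - e) t"
    using crossing_periodic_orbit_extension[OF cpo] by blast
  have gU: "g t \<in> U" for t using g(1) \<Gamma>(1) by auto
  have cross: "(g t \<bullet> c) * (L (g t - p0) \<bullet> g t) > 0" if "h (g t) = 0" for t
  proof -
    have "g t \<in> crossing_region X Y" using that g(1) \<Gamma>(2) by (auto simp: S1_eq)
    then show ?thesis using gU by (simp add: crossing_region_eq X Y inner_commute)
  qed
  \<comment> \<open>On the circle either field may occur; \<open>cross\<close> gives both the same
    radial sign.\<close>
  have rd: "\<exists>e>0. \<exists>v. (g has_vector_derivative v) (at t within {t..t + e}) \<and>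
      (v = c \<and> h (g t) \<le> 0 \<or> v = L (g t - p0) \<and> h (g t) \<ge> 0)" for t
  proof -
    obtain e where e: "e > 0" "pw_arc X Y g t (t + e)" using right by blast
    then have "t \<in> {t..t + e}" by simp
    with e show ?thesis unfolding pw_arc_def trajectory_arc_def using X[OF gU] Y[OF gU] by metis
  qed
  have ld: "\<exists>e>0. \<exists>v. (g has_vector_derivative v) (at t within {t - e..t}) \<and>
      (v = c \<and> h (g t) \<le> 0 \<or> v = L (g t - p0) \<and> h (g t) \<ge> 0)" for t
  proof -
    obtain e where e: "e > 0" "pw_arc X Y g (t - e) t" using left by blast
    then have "t \<in> {t - e..t}" by simp
    with e show ?thesis unfolding pw_arc_def trajectory_arc_def using X[OF gU] Y[OF gU] by metis
  qed
  have inside: "(g has_vector_derivative c) (at t)" if sgn: "h (g t) < 0" for t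
  proof -
    obtain e where "e > 0" "(g has_vector_derivative c) (at t within {t..t + e})"
      using rd[of t] sgn by (metis linorder_not_less)
    moreover obtain e' where "e' > 0" "(g has_vector_derivative c) (at t within {t - e'..t})"
      using ld[of t] sgn by (metis linorder_not_less)
    ultimately show ?thesis by (blast intro: has_vector_derivative_left_right)
  qed
  have outside: "(g has_vector_derivative L (g t - p0)) (at t)" if sgn: "h (g t) > 0" for t
  proof -
    obtain e where "e > 0" "(g has_vector_derivative L (g t - p0)) (at t within {t..t + e})"
      using rd[of t] sgn by (metis linorder_not_less)
    moreover obtain e' where "e' > 0" "(g has_vector_derivative L (g t - p0)) (at t within {t - e'..t})"
      using ld[of t] sgn by (metis linorder_not_less)
    ultimately show ?thesis by (blast intro: has_vector_derivative_left_right)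
  qed
  have "isCont g t" for t
    using rd[of t] ld[of t] isCont_left_right has_vector_derivative_continuous by metis
  then have cont: "continuous_on A g" for A
    by (simp add: continuous_at_imp_continuous_on)
  have hcont: "continuous_on A (\<lambda>t. h (g t))" for A
    unfolding h_eq by (intro continuous_intros cont)
  have exit: "\<exists>d>0. \<forall>r. 0 < r \<and> r < d \<longrightarrow> h (g (t + r)) > 0 \<and> h (g (t - r)) < 0"
    if z: "h (g t) = 0" and s: "g t \<bullet> c > 0" for t
  proof -
    have Ls: "L (g t - p0) \<bullet> g t > 0" using cross[OF z] s by (simp add: zero_less_mult_iff)
    obtain e v where e: "e > 0" and v: "(g has_vector_derivative v) (at t within {t..t + e})"
      and vs: "v \<bullet> g t > 0"
      using rd[of t] Ls s by (metis inner_commute)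
    obtain e' v' where e': "e' > 0" and v': "(g has_vector_derivative v') (at t within {t - e'..t})"
      and vs': "v' \<bullet> g t > 0"
      using ld[of t] Ls s by (metis inner_commute)
    obtain d where d: "d > 0" "\<And>r. r > 0 \<Longrightarrow> t + r \<in> {t..t + e} \<Longrightarrow> r < d \<Longrightarrow> h (g t) < h (g (t + r))"
      using has_real_derivative_pos_inc_right[OF h_comp_deriv[OF v]] vs by auto
    obtain d' where d': "d' > 0" "\<And>r. r > 0 \<Longrightarrow> t - r \<in> {t - e'..t} \<Longrightarrow> r < d' \<Longrightarrow> h (g (t - r)) < h (g t)"
      using has_real_derivative_pos_inc_left[OF h_comp_deriv[OF v']] vs' by auto
    show ?thesis
      using d d' e e' z by (intro exI[of _ "min (min d d') (min e e')"]) auto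
  qed
  have entry: "\<exists>d>0. \<forall>r. 0 < r \<and> r < d \<longrightarrow> h (g (t + r)) < 0 \<and> h (g (t - r)) > 0"
    if z: "h (g t) = 0" and s: "g t \<bullet> c < 0" for t
  proof -
    have Ls: "L (g t - p0) \<bullet> g t < 0" using cross[OF z] s by (simp add: zero_less_mult_iff)
    obtain e v where e: "e > 0" and v: "(g has_vector_derivative v) (at t within {t..t + e})"
      and vs: "v \<bullet> g t < 0"
      using rd[of t] Ls s by (metis inner_commute)
    obtain e' v' where e': "e' > 0" and v': "(g has_vector_derivative v') (at t within {t - e'..t})"
      and vs': "v' \<bullet> g t < 0"
      using ld[of t] Ls s by (metis inner_commute)
    obtain d where d: "d > 0" "\<And>r. r > 0 \<Longrightarrow> t + r \<in> {t..t + e} \<Longrightarrow> r < d \<Longrightarrow> h (g t) > h (g (t + r))"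
      using has_real_derivative_neg_dec_right[OF h_comp_deriv[OF v]] vs by auto
    obtain d' where d': "d' > 0" "\<And>r. r > 0 \<Longrightarrow> t - r \<in> {t - e'..t} \<Longrightarrow> r < d' \<Longrightarrow> h (g (t - r)) > h (g t)"
      using has_real_derivative_neg_dec_left[OF h_comp_deriv[OF v']] vs' by auto
    show ?thesis
      using d d' e e' z by (intro exI[of _ "min (min d d') (min e e')"]) auto
  qed
  have nz: "g t \<bullet> c \<noteq> 0" if "h (g t) = 0" for t
    using cross[OF that] by auto
  have next_exit: "\<exists>b>a. h (g b) = 0 \<and> g b \<bullet> c < 0 \<and> (\<forall>s\<in>{a<..<b}. h (g s) > 0) \<and>
      (\<forall>s\<in>{a..b}. g s = p0 + flow (s - a) (g a - p0))"
    if z: "h (g a) = 0" and s: "g a \<bullet> c > 0" for a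
  proof -
    obtain d where d: "d > 0" "\<And>r. 0 < r \<Longrightarrow> r < d \<Longrightarrow> h (g (a + r)) > 0"
      using exit[OF z s] by blast
    \<comment> \<open>Just after the exit but before \<open>a + T\<close>, where periodicity
      guarantees a zero that ends the excursion.\<close>
    define t where "t = a + min d T / 2"
    have t: "a < t" "t < a + d" "t < a + T" using d(1) T by (auto simp: t_def)
    have ht: "h (g t) > 0" and hz: "h (g (a + T)) = 0"
      using d(2)[of "t - a"] t z g(2) by auto
    obtain b where b: "t < b" "h (g b) = 0" "\<And>s. t \<le> s \<Longrightarrow> s < b \<Longrightarrow> h (g s) > 0"
      using next_zero[OF hcont ht hz t(3)] by metis
    have pos: "h (g s) > 0" if "s \<in> {a<..<b}" for s
      using that t d(2)[of "s - a"] b(3)[of s] by (cases "s < t") auto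
    have "\<not> g b \<bullet> c > 0"
    proof
      assume "g b \<bullet> c > 0"
      then obtain d' where d': "d' > 0" "\<And>r. 0 < r \<Longrightarrow> r < d' \<Longrightarrow> h (g (b - r)) < 0"
        using exit[OF b(2)] by blast
      let ?r = "min d' (b - a) / 2"
      have "0 < ?r" "?r < d'" "?r < b - a" using d' t b(1) by auto
      then show False using d'(2)[of ?r] pos[of "b - ?r"] by auto
    qed
    then have "g b \<bullet> c < 0" using nz[OF b(2)] by simp
    moreover have "g s = p0 + flow (s - a) (g a - p0)" if "s \<in> {a..b}" for s
      by (rule flow_unique[OF cont _ that]) (use outside pos in auto)
    moreover have "a < b" using b(1) t(1) by simp
    ultimately show ?thesis using pos b(2) by blast
  qed
  have next_entry: "\<exists>b>a. h (g b) = 0 \<and> g b \<bullet> c > 0 \<and> (\<forall>s\<in>{a..b}. g s = g a + (s - a) *\<^sub>R c)"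
    if z: "h (g a) = 0" and s: "g a \<bullet> c < 0" for a
  proof -
    obtain d where d: "d > 0" "\<And>r. 0 < r \<Longrightarrow> r < d \<Longrightarrow> h (g (a + r)) < 0"
      using entry[OF z s] by blast
    define t where "t = a + min d T / 2"
    have t: "a < t" "t < a + d" "t < a + T" using d(1) T by (auto simp: t_def)
    have ht: "- h (g t) > 0" and hz: "- h (g (a + T)) = 0"
      using d(2)[of "t - a"] t z g(2) by auto
    obtain b where b: "t < b" "h (g b) = 0" "\<And>s. t \<le> s \<Longrightarrow> s < b \<Longrightarrow> h (g s) < 0"
      using next_zero[OF continuous_on_minus[OF hcont] ht hz t(3)] by (metis neg_0_less_iff_less neg_equal_0_iff_equal)
    have neg: "h (g s) < 0" if "s \<in> {a<..<b}" for s
      using that t d(2)[of "s - a"] b(3)[of s] by (cases "s < t") auto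
    have "\<not> g b \<bullet> c < 0"
    proof
      assume "g b \<bullet> c < 0"
      then obtain d' where d': "d' > 0" "\<And>r. 0 < r \<Longrightarrow> r < d' \<Longrightarrow> h (g (b - r)) > 0"
        using entry[OF b(2)] by blast
      let ?r = "min d' (b - a) / 2"
      have "0 < ?r" "?r < d'" "?r < b - a" using d' t b(1) by auto
      then show False using d'(2)[of ?r] neg[of "b - ?r"] by auto
    qed
    then have "g b \<bullet> c > 0" using nz[OF b(2)] by simp
    moreover have "g s = g a + (s - a) *\<^sub>R c" if "s \<in> {a..b}" for s
      by (rule line_unique[OF cont _ that]) (use inside neg in auto)
    moreover have "a < b" using b(1) t(1) by simp
    ultimately show ?thesis using b(2) by blast
  qed
  have "\<Gamma> \<inter> S1 \<noteq> {}" using card by auto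
  then obtain t0 where t0: "h (g t0) = 0" using g(1) by (auto simp: S1_eq(1))
  \<comment> \<open>If the given circle time is an entry, the next zero is an exit.\<close>
  obtain a where a: "h (g a) = 0" "g a \<bullet> c > 0"
    using nz[OF t0] next_entry[OF t0] t0 by (metis linorder_neqE_linordered_idom)
  define q where "q = g a"
  obtain b where b: "a < b" "h (g b) = 0" "g b \<bullet> c < 0" "\<And>s. s \<in> {a<..<b} \<Longrightarrow> h (g s) > 0"
      "\<And>s. s \<in> {a..b} \<Longrightarrow> g s = p0 + flow (s - a) (q - p0)"
    using next_exit[OF a] unfolding q_def by blast
  define p where "p = g b"
  have pq: "p \<in> \<Gamma> \<inter> S1" "q \<in> \<Gamma> \<inter> S1" "p \<noteq> q"
    using a b(2,3) g(1) by (auto simp: p_def q_def S1_eq(1))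
  have two: "\<Gamma> \<inter> S1 = {p, q}"
  proof -
    have "finite (\<Gamma> \<inter> S1)" using card by (intro card_ge_0_finite) simp
    then show ?thesis
      using pq card by (intro card_subset_eq[symmetric]) auto
  qed
  \<comment> \<open>This is where having only two points enters: the direction of crossing already
    determines the point.\<close>
  have zero: "g t = (if g t \<bullet> c > 0 then q else p)" if "h (g t) = 0" for t
  proof -
    have "g t \<in> {p, q}" using that g(1) unfolding two[symmetric] by (auto simp: S1_eq(1))
    then show ?thesis using a(2) b(3) by (auto simp: p_def q_def)
  qed
  obtain b' where b': "b < b'" "h (g b') = 0" "g b' \<bullet> c > 0"
      "\<And>s. s \<in> {b..b'} \<Longrightarrow> g s = p + (s - b) *\<^sub>R c"
    using next_entry[OF b(2,3)] unfolding p_def by blast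
  define r where "r = b' - b"
  have r: "r > 0" "q = p + r *\<^sub>R c" using zero[OF b'(2)] b'(1,3) b'(4)[of b'] by (auto simp: r_def)
  have c0: "c \<noteq> 0" using a by auto
  have hq: "h q = 0" and hp: "h p = 0" using a(1) b(2) by (auto simp: p_def q_def)
  have mirror: "p = mirror q" by (rule mirror_eqI[OF _ r(2,1) c0]) (use hq hp in \<open>simp add: h_eq\<close>)
  have fb: "p0 + flow (b - a) (q - p0) = p" using b(5)[of b] b(1) by (simp add: p_def)
  have "cyc q (b - a)"
    unfolding cyc_def
  proof (intro conjI ballI)
    show "q \<bullet> q = 1" using hq by (simp add: h_eq)
    show "q \<bullet> c > 0" using a(2) by (simp add: q_def)
    then show "L (q - p0) \<bullet> q > 0" using cross[OF a(1)] by (simp add: q_def zero_less_mult_iff)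
    show "0 < b - a" using b(1) by simp
    show "p0 + flow (b - a) (q - p0) = mirror q" using fb mirror by simp
    fix s assume "s \<in> {0<..<b - a}"
    then show "0 < h (p0 + flow s (q - p0))" using b(4)[of "a + s"] b(5)[of "a + s"] by auto
  qed
  moreover have "\<Gamma> = cyc_set q (b - a)"
  proof
    show "cyc_set q (b - a) \<subseteq> \<Gamma>"
      unfolding cyc_set_def mirror[symmetric]
    proof (intro Un_least subsetI)
      fix z assume "z \<in> closed_segment p q"
      then obtain u where u: "0 \<le> u" "u \<le> 1" "z = (1 - u) *\<^sub>R p + u *\<^sub>R q"
        by (auto simp: in_segment)
      have "z = p + (u * r) *\<^sub>R c" unfolding u r(2) by (simp add: algebra_simps)
      moreover have "0 \<le> u * r" "u * r \<le> r" using u r(1) mult_right_mono[of u 1 r] by auto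
      then have "b + u * r \<in> {b..b'}" by (simp add: r_def)
      ultimately have "z = g (b + u * r)" using b'(4)[of "b + u * r"] by simp
      then show "z \<in> \<Gamma>" using g(1) by auto
    next
      fix z assume "z \<in> (\<lambda>s. p0 + flow s (q - p0)) ` {0..b - a}"
      then obtain s where "s \<in> {0..b - a}" "z = p0 + flow s (q - p0)" by auto
      then have "z = g (a + s)" using b(5)[of "a + s"] by simp
      then show "z \<in> \<Gamma>" using g(1) by auto
    qed
    show "\<Gamma> \<subseteq> cyc_set q (b - a)"
    proof
      fix z assume "z \<in> \<Gamma>"
      then obtain t0 where t0: "z = g t0" using g(1) by auto
      have per: "g (t + real n * T) = g t" for t n
        by (induction n) (use g(2)[of "t + real _ * T"] in \<open>simp_all add: algebra_simps\<close>)
      \<comment> \<open>Shifting by whole periods past \<open>a\<close> provides the zero on the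
        left that \<open>last_zero\<close> asks for.\<close>
      obtain n where "a - t0 < real n * T" using ex_less_of_nat_mult[OF T] by blast
      then obtain t where t: "z = g t" "a < t" using per[of t0 n] t0 by (metis diff_less_eq add.commute)
      consider "h z = 0" | "h z > 0" | "h z < 0" by linarith
      then show "z \<in> cyc_set q (b - a)"
      proof cases
        case 1
        then have "z = q \<or> z = p" using zero[of t] t by metis
        then show ?thesis by (auto simp: cyc_set_def mirror[symmetric])
      next
        case 2
        obtain a' where a': "a' < t" "h (g a') = 0" "\<And>s. a' < s \<Longrightarrow> s \<le> t \<Longrightarrow> h (g s) > 0"
          using last_zero[OF hcont, of t a] 2 t a(1) by metis
        have "\<not> g a' \<bullet> c < 0"
        proof
          assume "g a' \<bullet> c < 0"
          then obtain d where d: "d > 0" "\<And>r. 0 < r \<Longrightarrow> r < d \<Longrightarrow> h (g (a' + r)) < 0"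
            using entry[OF a'(2)] by blast
          let ?r = "min d (t - a') / 2"
          have "0 < ?r" "?r < d" "?r < t - a'" using d a'(1) by auto
          then show False using d(2)[of ?r] a'(3)[of "a' + ?r"] by auto
        qed
        then have ga': "g a' = q" using zero[OF a'(2)] nz[OF a'(2)] by auto
        have gs: "g s = p0 + flow (s - a') (q - p0)" if "s \<in> {a'..t}" for s
          unfolding ga'[symmetric]
          by (rule flow_unique[OF cont _ that]) (use outside a'(3) in auto)
        \<comment> \<open>A longer excursion would reach the circle point \<open>p\<close> while
          still strictly outside.\<close>
        have "t - a' < b - a"
        proof (rule ccontr)
          assume "\<not> t - a' < b - a"
          then have "g (a' + (b - a)) = p" "h (g (a' + (b - a))) > 0"
            using gs[of "a' + (b - a)"] fb b(1) a'(3)[of "a' + (b - a)"] by simp_all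
          then show False using hp by simp
        qed
        then show ?thesis using gs[of t] a'(1) t(1) by (auto simp: cyc_set_def)
      next
        case 3
        have hc: "continuous_on UNIV (\<lambda>s. - h (g s))" by (intro continuous_intros hcont)
        obtain a' where a': "a' < t" "h (g a') = 0" "\<And>s. a' < s \<Longrightarrow> s \<le> t \<Longrightarrow> h (g s) < 0"
          using last_zero[OF hc, of t a] 3 t a(1) by auto
        have "\<not> g a' \<bullet> c > 0"
        proof
          assume "g a' \<bullet> c > 0"
          then obtain d where d: "d > 0" "\<And>r. 0 < r \<Longrightarrow> r < d \<Longrightarrow> h (g (a' + r)) > 0"
            using exit[OF a'(2)] by blast
          let ?r = "min d (t - a') / 2"
          have "0 < ?r" "?r < d" "?r < t - a'" using d a'(1) by auto
          then show False using d(2)[of ?r] a'(3)[of "a' + ?r"] by auto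
        qed
        then have ga': "g a' = p" using zero[OF a'(2)] nz[OF a'(2)] by auto
        have gs: "g s = p + (s - a') *\<^sub>R c" if "s \<in> {a'..t}" for s
          unfolding ga'[symmetric]
          by (rule line_unique[OF cont _ that]) (use inside a'(3) in auto)
        have lt: "t - a' < r"
        proof (rule ccontr)
          assume "\<not> t - a' < r"
          then have "g (a' + r) = q" "h (g (a' + r)) < 0"
            using gs[of "a' + r"] r a'(3)[of "a' + r"] by simp_all
          then show False using hq by simp
        qed
        define w where "w = (t - a') / r"
        have "z = p + (w * r) *\<^sub>R c" using gs[of t] a'(1) t(1) r(1) by (simp add: w_def)
        then have "z = (1 - w) *\<^sub>R p + w *\<^sub>R q" unfolding r(2) by (simp add: algebra_simps)
        moreover have "0 \<le> w" "w \<le> 1" using lt a'(1) r(1) by (auto simp: w_def)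
        ultimately have "z \<in> closed_segment p q" unfolding in_segment by blast
        then show ?thesis by (simp add: cyc_set_def mirror[symmetric])
      qed
    qed
  qed
  ultimately show ?thesis by (rule that)
qed

end

section \<open>Uniqueness and the reversible case\<close>

lemma wedge_rot: "wedge u v = rot u \<bullet> v"
  by (simp add: wedge_def rot_def inner_vec2)

lemma rot_inner: "rot u \<bullet> rot v = u \<bullet> v" "u \<bullet> rot u = 0" "rot u \<bullet> u = 0"
  by (simp_all add: rot_def inner_vec2)

lemma rot_rot: "rot (rot u) = - u"
  by (simp add: vec2_eq_iff rot_def)

lemma frame_decomp:
  assumes "c \<noteq> 0"
  shows "v = (v \<bullet> rot c / (c \<bullet> c)) *\<^sub>R rot c + (v \<bullet> c / (c \<bullet> c)) *\<^sub>R c"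
proof -
  have "(c \<bullet> c) *\<^sub>R v = (v \<bullet> rot c) *\<^sub>R rot c + (v \<bullet> c) *\<^sub>R c"
    by (simp add: vec2_eq_iff inner_vec2 rot_def algebra_simps)
  then have "v = (1 / (c \<bullet> c)) *\<^sub>R ((v \<bullet> rot c) *\<^sub>R rot c + (v \<bullet> c) *\<^sub>R c)"
    using assms by (metis divide_inverse_commute inner_eq_zero_iff mult_1 scaleR_one scaleR_scaleR
        right_inverse mult.commute inverse_eq_divide)
  then show ?thesis by (simp add: scaleR_right_distrib)
qed

text \<open>At weight \<open>w\<close> the value of \<open>h\<close> is \<open>- w (1 - w)\<close>
  times the squared length of the chord.\<close>

lemma chord_in_disc:
  assumes "h p = 0" "h q = 0" "z \<in> closed_segment p q"
  shows "h z \<le> 0" "h z = 0 \<Longrightarrow> z = p \<or> z = q"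
proof -
  obtain w where w: "0 \<le> w" "w \<le> 1" "z = (1 - w) *\<^sub>R p + w *\<^sub>R q"
    using assms(3) by (auto simp: in_segment)
  have pq: "p \<bullet> p = 1" "q \<bullet> q = 1" using assms(1,2) by (auto simp: h_eq)
  have "h z = - (w * (1 - w) * ((p - q) \<bullet> (p - q)))"
    unfolding w(3) h_eq
    by (simp add: inner_add inner_diff inner_commute[of q p] pq algebra_simps power2_eq_square)
  note hz = this
  have "0 \<le> w * (1 - w) * ((p - q) \<bullet> (p - q))" using w by simp
  with hz show "h z \<le> 0" by simp
  assume "h z = 0"
  with hz have "w = 0 \<or> w = 1 \<or> p = q" by auto
  then show "z = p \<or> z = q" using w(3) by (auto simp flip: scaleR_left_distrib)
qed

context disc_flow
begin

lemma mirror_simps: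
  "mirror (u + v) = mirror u + mirror v" "mirror (u - v) = mirror u - mirror v"
  "mirror (r *\<^sub>R v) = r *\<^sub>R mirror v"
  by (simp_all add: mirror_def inner_add inner_diff algebra_simps add_divide_distrib diff_divide_distrib
      flip: scaleR_left_distrib scaleR_left_diff_distrib)

lemma mirror_c: "c \<noteq> 0 \<Longrightarrow> mirror u \<bullet> c = - (u \<bullet> c)"
  by (simp add: mirror_def inner_diff)

lemma mirror_inner: "c \<noteq> 0 \<Longrightarrow> mirror u \<bullet> mirror v = u \<bullet> v"
  by (simp add: mirror_def inner_diff inner_commute field_simps)

lemma norm_mirror: "c \<noteq> 0 \<Longrightarrow> norm (mirror u) = norm u"
  by (simp add: norm_eq_sqrt_inner mirror_inner)

lemma h_mirror: "c \<noteq> 0 \<Longrightarrow> h (mirror z) = h z"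
  by (simp add: h_eq mirror_inner)

text \<open>In the orthogonal frame the midpoint is \<open>x q\<close> times \<open>rot c\<close>,
  so \<open>cyc_wedge\<close> is one linear equation for \<open>x q\<close>. The unit circle then
  gives the square of \<open>y q\<close>, and \<open>q \<bullet> c > 0\<close> its sign.\<close>

lemma cyc_determined:
  assumes "wedge c (L (rot c)) \<noteq> 0" "cyc q t" "cyc q' t'"
  shows "q = q'"
proof -
  have c0: "c \<noteq> 0" using assms(2) by (auto simp: cyc_def)
  define x y where "x q = q \<bullet> rot c / (c \<bullet> c)" and "y q = q \<bullet> c / (c \<bullet> c)" for q
  have dec: "q = x q *\<^sub>R rot c + y q *\<^sub>R c" for q
    unfolding x_def y_def by (rule frame_decomp[OF c0])
  have x: "x q * wedge c (L (rot c)) = wedge c (L p0)" if "cyc q t" for q t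
  proof -
    have "q - y q *\<^sub>R c - p0 = x q *\<^sub>R rot c - p0" using dec[of q] by (metis add_diff_cancel_right')
    then show ?thesis using cyc_wedge[OF that] by (simp add: L_simps wedge_simps flip: y_def)
  qed
  have y: "(y q)\<^sup>2 = 1 / (c \<bullet> c) - (x q)\<^sup>2" "y q > 0" if "cyc q t" for q t
  proof -
    have "q \<bullet> q = q \<bullet> (x q *\<^sub>R rot c + y q *\<^sub>R c)" by (simp flip: dec)
    also have "\<dots> = x q * (q \<bullet> rot c) + y q * (q \<bullet> c)" by (simp add: inner_add)
    also have "\<dots> = ((x q)\<^sup>2 + (y q)\<^sup>2) * (c \<bullet> c)"
      using c0 by (simp add: x_def y_def power2_eq_square field_simps)
    finally have "q \<bullet> q = ((x q)\<^sup>2 + (y q)\<^sup>2) * (c \<bullet> c)" .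
    then show "(y q)\<^sup>2 = 1 / (c \<bullet> c) - (x q)\<^sup>2"
      using that c0 by (simp add: cyc_def field_simps)
    show "y q > 0" using that c0 by (simp add: cyc_def y_def)
  qed
  have "x q = x q'" using x[OF assms(2)] x[OF assms(3)] assms(1) by (metis mult_cancel_right)
  moreover have "(y q)\<^sup>2 = (y q')\<^sup>2"
    unfolding y(1)[OF assms(2)] y(1)[OF assms(3)] \<open>x q = x q'\<close> ..
  then have "y q = y q'"
    by (rule power2_eq_imp_eq[OF _ less_imp_le[OF y(2)[OF assms(2)]] less_imp_le[OF y(2)[OF assms(3)]]])
  ultimately show ?thesis using dec[of q] dec[of q'] by metis
qed

text \<open>Scaling about \<open>p0\<close> moves a point by \<open>|l - 1|\<close> times the norm
  of the flow, which is bounded on \<open>K\<close>, and compactness leaves a uniform margin inside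
  \<open>W\<close>.\<close>

lemma compact_tube:
  assumes "compact K" "open W" "\<And>s. s \<in> K \<Longrightarrow> p0 + flow s u \<in> W"
  obtains e where "e > 0" "\<And>l s. \<bar>l - 1\<bar> < e \<Longrightarrow> s \<in> K \<Longrightarrow> p0 + l *\<^sub>R flow s u \<in> W"
proof -
  have cf: "continuous_on K (\<lambda>s. flow s u)"
    by (rule continuous_on_vector_derivative[OF flow_deriv])
  have "compact ((\<lambda>s. p0 + flow s u) ` K)"
    by (intro compact_continuous_image assms(1) continuous_intros cf)
  moreover have "(\<lambda>s. p0 + flow s u) ` K \<subseteq> W" using assms(3) by auto
  ultimately obtain r where r: "r > 0" "(\<Union>x\<in>(\<lambda>s. p0 + flow s u) ` K. ball x r) \<subseteq> W"
    using compact_subset_open_imp_ball_epsilon_subset[OF _ assms(2)] by metis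
  have "bounded ((\<lambda>s. flow s u) ` K)"
    by (intro compact_imp_bounded compact_continuous_image assms(1) cf)
  then obtain M where M: "M > 0" "\<And>s. s \<in> K \<Longrightarrow> norm (flow s u) \<le> M"
    unfolding bounded_pos by auto
  show ?thesis
  proof (rule that[of "r / M"])
    show "r / M > 0" using r M by simp
    fix l s assume l: "\<bar>l - 1\<bar> < r / M" and s: "s \<in> K"
    have "(p0 + l *\<^sub>R flow s u) - (p0 + flow s u) = (l - 1) *\<^sub>R flow s u"
      by (simp add: algebra_simps)
    then have "dist (p0 + flow s u) (p0 + l *\<^sub>R flow s u) = \<bar>l - 1\<bar> * norm (flow s u)"
      by (metis dist_commute dist_norm norm_scaleR)
    also have "\<dots> \<le> \<bar>l - 1\<bar> * M" using M(2)[OF s] by (simp add: mult_left_mono)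
    also have "\<dots> < r" using l M(1) by (simp add: field_simps)
    finally have "p0 + l *\<^sub>R flow s u \<in> ball (p0 + flow s u) r" by (simp only: mem_ball)
    then show "p0 + l *\<^sub>R flow s u \<in> W" using r(2) s by blast
  qed
qed

section \<open>The degenerate case: reversibility under the mirror\<close>

context
  fixes q :: "real^2" and t :: real
  assumes cyc: "cyc q t" and sym: "wedge c (L (rot c)) = 0"
begin

lemma c_nonzero: "c \<noteq> 0"
  using cyc by (auto simp: cyc_def)

lemma eq_0_if_orth: "w \<bullet> rot c = 0 \<Longrightarrow> w \<bullet> c = 0 \<Longrightarrow> w = 0"
  using frame_decomp[OF c_nonzero, of w] by simp

lemma L_eq_0: "L v = 0 \<Longrightarrow> v = 0"
  using LL[of v] k L_simps(3)[of 0 0] by simp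

lemma L_rot_c: "L (rot c) \<bullet> rot c = 0"
  using sym by (simp add: wedge_rot inner_commute)

text \<open>By trace zero the diagonal entries of \<open>L\<close> in the orthogonal frame are
  opposite; the other one vanishes by \<open>L_rot_c\<close>.\<close>

lemma L_c: "L c \<bullet> c = 0"
proof -
  have "wedge (rot c) (L c) = 0" using wedge_sym[of "rot c" c] sym by simp
  then show ?thesis by (simp add: wedge_rot rot_rot inner_commute)
qed

text \<open>In the frame \<open>rot c\<close>, \<open>c\<close> the map \<open>L\<close> is
  off-diagonal and the mirror is diagonal with entries 1 and -1, so they anticommute.\<close>

lemma L_mirror: "L (mirror v) = - mirror (L v)"
proof -
  define x y where "x = v \<bullet> rot c / (c \<bullet> c)" and "y = v \<bullet> c / (c \<bullet> c)"
  have v: "v = x *\<^sub>R rot c + y *\<^sub>R c"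
    unfolding x_def y_def by (rule frame_decomp[OF c_nonzero])
  have 1: "mirror (rot c) = rot c" "mirror c = - c" "mirror (L c) = L c"
    using c_nonzero by (simp_all add: mirror_def rot_inner L_c scaleR_2)
  have 2: "mirror (L (rot c)) = - L (rot c)"
  proof -
    obtain a where "L (rot c) = a *\<^sub>R c"
      using frame_decomp[OF c_nonzero, of "L (rot c)"] L_rot_c by auto
    then show ?thesis by (simp add: mirror_simps 1)
  qed
  show ?thesis unfolding v by (simp add: mirror_simps L_simps 1 2)
qed

text \<open>The midpoint drops out of \<open>cyc_wedge\<close>, leaving
  \<open>wedge c (L p0) = 0\<close>. Only the component of \<open>p0\<close> along \<open>c\<close>
  contributes, with nonzero factor \<open>wedge c (L c)\<close>.\<close>

lemma mirror_p0: "mirror p0 = p0"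
proof -
  have wc: "wedge c (L c) \<noteq> 0"
    using eq_0_if_orth[of "L c"] L_c L_eq_0 c_nonzero by (auto simp: wedge_rot inner_commute)
  let ?m = "q - ((q \<bullet> c) / (c \<bullet> c)) *\<^sub>R c"
  have "wedge c (L ?m) = 0"
  proof -
    obtain x where "?m = x *\<^sub>R rot c"
      using frame_decomp[OF c_nonzero, of q] by (metis add_diff_cancel_right')
    then show ?thesis by (simp add: L_simps wedge_simps sym)
  qed
  with cyc_wedge[OF cyc] have "wedge c (L p0) = 0" by (simp add: L_simps wedge_simps)
  then have "(p0 \<bullet> c / (c \<bullet> c)) * wedge c (L c) = 0"
    by (subst (asm) frame_decomp[OF c_nonzero, of p0]) (simp add: L_simps wedge_simps sym)
  then have "p0 \<bullet> c = 0" using wc c_nonzero by simp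
  then show ?thesis by (simp add: mirror_def)
qed

lemma flow_return: "flow t (q - p0) = mirror (q - p0)"
  using cyc by (simp add: cyc_def mirror_simps mirror_p0 algebra_simps)

text \<open>The mirror reverses time, and \<open>flow_return\<close> identifies the reflected
  starting point with the point at time \<open>t\<close>.\<close>

lemma mirror_flow: "mirror (flow s (q - p0)) = flow (t - s) (q - p0)"
  unfolding flow_diff flow_return L_mirror by (simp add: flow_def mirror_simps)

text \<open>Scaling could not change a zero Hamiltonian, as on a separatrix of a saddle. But at time
  \<open>t / 2\<close> the arc meets the mirror axis, where the form vanishes only at
  \<open>p0\<close>.\<close>

lemma wedge_nonzero: "wedge (q - p0) (L (q - p0)) \<noteq> 0"
proof -
  define w where "w = flow (t / 2) (q - p0)"
  have "mirror w = w" using mirror_flow[of "t / 2"] by (simp add: w_def)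
  then have wc: "w \<bullet> c = 0" using mirror_c[OF c_nonzero, of w] by simp
  have "w \<noteq> 0"
  proof
    assume "w = 0"
    then have "flow (t / 2 - t / 2) (q - p0) = 0"
      unfolding flow_diff by (simp add: w_def[symmetric] L_simps(3)[of 0 0, simplified])
    then have "L (q - p0) = 0" using L_simps(3)[of 0 0] by simp
    then show False using cyc by (simp add: cyc_def)
  qed
  obtain x where x: "w = x *\<^sub>R rot c" using frame_decomp[OF c_nonzero, of w] wc by auto
  have "wedge (rot c) (L (rot c)) = - (c \<bullet> L (rot c))" by (simp add: wedge_rot rot_rot)
  moreover have "c \<bullet> L (rot c) \<noteq> 0"
    using eq_0_if_orth[of "L (rot c)"] L_rot_c L_eq_0[of "rot c"] rot_inner(1)[of c c] c_nonzero
    by (auto simp: inner_commute)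
  ultimately have "wedge w (L w) \<noteq> 0"
    using \<open>w \<noteq> 0\<close> x by (auto simp: L_simps wedge_simps)
  then show ?thesis by (simp add: w_def wedge_flow)
qed

end

end

section \<open>Nearby cycles in the degenerate case, and the conclusion\<close>

context disc_flow
begin

text \<open>Scaling about \<open>p0\<close> commutes with the flow and with the mirror, so a scaled copy of the outer
  arc, cut at its first point \<open>q1\<close> on the circle and at \<open>mirror q1\<close>, closes up along a chord.  The
  new cycle differs from the old one because scaling by \<open>l\<close> multiplies the Hamiltonian by \<open>l\<^sup>2\<close>.\<close>

lemma cyc_perturb:
  assumes cyc: "cyc q t" and sym: "wedge c (L (rot c)) = 0"
    and V: "open V" "V \<subseteq> U" "cyc_set q t \<subseteq> V"
  obtains \<Gamma>' where "crossing_periodic_orbit U X Y \<Gamma>'" "\<Gamma>' \<subseteq> V" "\<Gamma>' \<noteq> cyc_set q t"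
proof -
  note c0 = c_nonzero[OF cyc sym]
  define u where "u = q - p0"
  have q: "q \<bullet> q = 1" "q \<bullet> c > 0" "L (q - p0) \<bullet> q > 0" "t > 0"
    and arc: "\<And>s. s \<in> {0<..<t} \<Longrightarrow> h (p0 + flow s u) > 0"
    using cyc by (auto simp: cyc_def u_def)
  have hq: "h q = 0" using q by (simp add: h_eq)
  define F where "F l s = p0 + l *\<^sub>R flow s u" for l s
  have F1: "F 1 s = p0 + flow s u" for s by (simp add: F_def)
  have F10: "F 1 0 = q" by (simp add: F1 u_def)
  have mF: "mirror (F l s) = F l (t - s)" for l s
    by (simp add: F_def mirror_simps mirror_p0[OF cyc sym] mirror_flow[OF cyc sym] u_def)
  have hF: "h (F l (t - s)) = h (F l s)" for l s
    using h_mirror[OF c0, of "F l s"] unfolding mF .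
  have Fd: "(F l has_vector_derivative L (F l s - p0)) (at s within A)" for l s A
  proof -
    have "((\<lambda>s. p0 + l *\<^sub>R flow s u) has_vector_derivative l *\<^sub>R L (flow s u)) (at s within A)"
      using has_vector_derivative_add[OF has_vector_derivative_const[of p0]
          has_vector_derivative_scaleR[OF DERIV_const[of l] flow_deriv[of u s A]]] by simp
    then show ?thesis by (simp add: F_def[abs_def] L_simps)
  qed
  have Fc: "continuous_on A (F l)" for A l
    by (rule continuous_on_vector_derivative[OF Fd])
  have hc: "continuous_on A (\<lambda>s. h (F l s))" for A l
    unfolding h_eq by (intro continuous_intros Fc)

  have "closed_segment (mirror q) q \<subseteq> V" using V(3) by (simp add: cyc_set_def)
  from compact_subset_open_imp_ball_epsilon_subset[OF compact_segment V(1) this]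
  obtain e where e: "e > 0" "(\<Union>x\<in>closed_segment (mirror q) q. ball x e) \<subseteq> V" by blast
  have bl: "bounded_linear L" using lin by (rule linear_linear[THEN iffD2])
  \<comment> \<open>Points near \<open>q\<close> where both fields point outwards; the radius
    \<open>e\<close> keeps the chord from such a point to its reflection inside
    \<open>V\<close>.\<close>
  define W where "W = {z. 0 < L (z - p0) \<bullet> z} \<inter> {z. 0 < z \<bullet> c} \<inter> ball q e"
  have W: "open W"
    unfolding W_def
    by (intro open_Int open_Collect_less continuous_intros bounded_linear.continuous_on[OF bl]) simp
  have "q \<in> W" using q e(1) by (simp add: W_def)
  have nearV: "(1 - w) *\<^sub>R mirror z + w *\<^sub>R z \<in> V" if z: "z \<in> W" and w: "0 \<le> w" "w \<le> 1" for z w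
  proof -
    let ?x = "(1 - w) *\<^sub>R mirror q + w *\<^sub>R q" and ?y = "(1 - w) *\<^sub>R mirror z + w *\<^sub>R z"
    have "?x - ?y = (1 - w) *\<^sub>R mirror (q - z) + w *\<^sub>R (q - z)"
      by (simp add: mirror_simps algebra_simps)
    then have "norm (?x - ?y) \<le> norm ((1 - w) *\<^sub>R mirror (q - z)) + norm (w *\<^sub>R (q - z))"
      by (simp only: norm_triangle_ineq)
    also have "\<dots> = (1 - w) * norm (q - z) + w * norm (q - z)"
      using w by (simp add: norm_mirror[OF c0])
    also have "\<dots> = norm (q - z)" by (simp add: left_diff_distrib)
    also have "\<dots> < e" using z by (simp add: W_def dist_norm)
    finally have "?y \<in> ball ?x e" by (simp add: dist_norm)
    moreover have "?x \<in> closed_segment (mirror q) q" using w unfolding in_segment by blast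
    ultimately show ?thesis using e(2) by blast
  qed

  \<comment> \<open>Negative times are included because the scaled arc may meet the circle before
    time 0; \<open>d < t / 2\<close> leaves a middle stretch that is strictly outside.\<close>
  obtain d where d: "d > 0" "d < t / 2" "\<And>s. \<bar>s\<bar> \<le> d \<Longrightarrow> F 1 s \<in> W"
  proof -
    have "open (F 1 -` W)" by (intro open_vimage W Fc)
    moreover have "0 \<in> F 1 -` W" using \<open>q \<in> W\<close> F10 by simp
    ultimately obtain d' where d': "d' > 0" "ball 0 d' \<subseteq> F 1 -` W" by (rule openE)
    show ?thesis
      by (rule that[of "min d' (t / 2) / 2"]) (use d' q(4) in \<open>auto simp: subset_iff\<close>)
  qed
  have incr: "h (F l a) < h (F l b)" if "\<And>s. \<bar>s\<bar> \<le> d \<Longrightarrow> F l s \<in> W" "- d \<le> a" "a < b" "b \<le> d" for l a b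
  proof (rule DERIV_pos_imp_increasing[OF \<open>a < b\<close>])
    fix s assume "a \<le> s" "s \<le> b"
    then have "F l s \<in> W" using that by simp
    then have "2 * (L (F l s - p0) \<bullet> F l s) > 0" by (simp add: W_def)
    then show "\<exists>y. ((\<lambda>s. h (F l s)) has_real_derivative y) (at s) \<and> 0 < y"
      using h_comp_deriv[OF Fd] by blast
  qed
  have "h (F 1 (- d)) < 0"
    using incr[of 1 "- d" 0] d F10 hq by simp
  have oh: "open {z. h z < 0}" "open {z. 0 < h z}"
    unfolding h_eq by (intro open_Collect_less continuous_intros)+
  \<comment> \<open>The three bounds control the exit window, the middle stretch and the point
    inside the disc; the entry window follows by reflection.\<close>
  obtain e1 where e1: "e1 > 0" "\<And>l s. \<bar>l - 1\<bar> < e1 \<Longrightarrow> s \<in> {- d..d} \<Longrightarrow> F l s \<in> W"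
    by (rule compact_tube[of "{- d..d}" W u]) (use W d(3) in \<open>auto simp: F_def\<close>)
  obtain e2 where e2: "e2 > 0" "\<And>l s. \<bar>l - 1\<bar> < e2 \<Longrightarrow> s \<in> {d..t - d} \<Longrightarrow> F l s \<in> V \<inter> {z. 0 < h z}"
  proof (rule compact_tube[of "{d..t - d}" "V \<inter> {z. 0 < h z}" u])
    fix s assume s: "s \<in> {d..t - d}"
    then have "p0 + flow s u \<in> cyc_set q t" using d(1) by (auto simp: cyc_set_def u_def)
    then show "p0 + flow s u \<in> V \<inter> {z. 0 < h z}" using arc[of s] s d(1) V(3) by auto
  qed (use oh V in \<open>auto simp: F_def\<close>)
  obtain e3 where e3: "e3 > 0" "\<And>l s. \<bar>l - 1\<bar> < e3 \<Longrightarrow> s \<in> {- d} \<Longrightarrow> F l s \<in> {z. h z < 0}"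
    by (rule compact_tube[of "{- d}" "{z. h z < 0}" u])
      (use oh \<open>h (F 1 (- d)) < 0\<close> in \<open>auto simp: F_def\<close>)

  define l where "l = 1 + min e1 (min e2 e3) / 2"
  have l: "l > 1" "\<bar>l - 1\<bar> < e1" "\<bar>l - 1\<bar> < e2" "\<bar>l - 1\<bar> < e3"
    using e1(1) e2(1) e3(1) by (auto simp: l_def)
  have lW: "F l s \<in> W" if "\<bar>s\<bar> \<le> d" for s using e1(2)[OF l(2), of s] that by (simp add: abs_le_iff)
  have "h (F l (- d)) \<le> 0" using e3(2)[OF l(4)] by (simp add: less_imp_le)
  moreover have "0 \<le> h (F l d)" using e2(2)[OF l(3), of d] d by (simp add: less_imp_le)
  ultimately obtain a where "- d \<le> a" "a \<le> d" and a0: "h (F l a) = 0"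
    using IVT'[of "\<lambda>s. h (F l s)" "- d" 0 d] hc d(1) by auto
  then have a: "\<bar>a\<bar> \<le> d" "h (F l a) = 0" by auto
  define q1 where "q1 = F l a"
  have q1: "h q1 = 0" "q1 \<in> W" using a lW by (auto simp: q1_def)
  have mq1: "mirror q1 = F l (t - a)" by (simp add: q1_def mF)
  have hm: "h (mirror q1) = 0" using q1 by (simp add: h_mirror[OF c0])
  have at: "a < t - a" using a(1) d(2) by auto
  have pos: "h (F l s) > 0" if "a < s" "s < t - a" for s
  proof -
    have near: "h (F l s) > 0" if "a < s" "s \<le> d" for s
      using incr[of l a s] lW a that by auto
    consider "s \<le> d" | "s \<in> {d..t - d}" | "t - d < s" by fastforce
    then show ?thesis
    proof cases
      case 1 then show ?thesis using near that by simp
    next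
      case 2 then show ?thesis using e2(2)[OF l(3)] by simp
    next
      case 3
      then have "h (F l (t - s)) > 0" using that by (intro near) auto
      then show ?thesis by (simp add: hF)
    qed
  qed
  have segV: "z \<in> V" if "z \<in> closed_segment (mirror q1) q1" for z
    using that nearV[OF q1(2)] by (auto simp: in_segment)
  have inV: "F l s \<in> V" if bounds: "a \<le> s" "s \<le> t - a" for s
  proof -
    \<comment> \<open>Weight 1 in \<open>nearV\<close> gives the point itself, weight 0 its
      reflection; the latter covers the entry window.\<close>
    consider "\<bar>s\<bar> \<le> d" | "s \<in> {d..t - d}" | "\<bar>t - s\<bar> \<le> d" using bounds a(1) by fastforce
    then show ?thesis
    proof cases
      case 1 then show ?thesis using nearV[OF lW, of s 1] by simp
    next
      case 2 then show ?thesis using e2(2)[OF l(3)] by simp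
    next
      case 3 then show ?thesis using nearV[OF lW, of "t - s" 0] by (simp add: mF)
    qed
  qed

  \<comment> \<open>\<open>T1\<close> is the time on the scaled arc from \<open>a\<close> to the
    reflected time \<open>t - a\<close>; \<open>T2\<close> is the chord length
    \<open>2 (q1 \<bullet> c) / |c|\<close> divided by the speed \<open>|c|\<close>.\<close>
  define T1 T2 where "T1 = t - a - a" and "T2 = 2 * (q1 \<bullet> c) / (c \<bullet> c)"
  have qc: "q1 \<bullet> c > 0" using q1 by (simp add: W_def)
  have T: "T1 > 0" "T2 > 0" using at qc c0 by (auto simp: T1_def T2_def)
  have T2: "mirror q1 + T2 *\<^sub>R c = q1" by (simp add: mirror_def T2_def)
  define \<gamma> where "\<gamma> s = (if s \<le> T1 then F l (s + a) else mirror q1 + (s - T1) *\<^sub>R c)" for s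
  have \<gamma>1: "\<gamma> s = F l (s + a)" if "s \<in> {0..T1}" for s using that by (simp add: \<gamma>_def)
  have \<gamma>2: "\<gamma> s = mirror q1 + (s - T1) *\<^sub>R c" if "s \<in> {T1..T1 + T2}" for s
    using that mq1 by (auto simp: \<gamma>_def T1_def)
  have seg: "\<gamma> s \<in> closed_segment (mirror q1) q1" if "s \<in> {T1..T1 + T2}" for s
  proof -
    define w where "w = (s - T1) / T2"
    have "\<gamma> s = mirror q1 + (w * T2) *\<^sub>R c" using \<gamma>2[OF that] T by (simp add: w_def)
    then have "\<gamma> s = (1 - w) *\<^sub>R mirror q1 + w *\<^sub>R (mirror q1 + T2 *\<^sub>R c)"
      by (simp add: algebra_simps)
    moreover have "0 \<le> w" "w \<le> 1" using that T by (auto simp: w_def)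
    ultimately show ?thesis unfolding T2 in_segment by blast
  qed
  define \<Gamma>' where "\<Gamma>' = \<gamma> ` {0..T1 + T2}"
  have cases: "s \<in> {0..T1} \<or> s \<in> {T1..T1 + T2}" if "s \<in> {0..T1 + T2}" for s using that by auto
  have \<Gamma>V: "\<Gamma>' \<subseteq> V"
  proof -
    have "\<gamma> s \<in> V" if "s \<in> {0..T1 + T2}" for s
      using cases[OF that] \<gamma>1[of s] inV[of "s + a"] segV[OF seg, of s] by (auto simp: T1_def)
    then show ?thesis by (auto simp: \<Gamma>'_def)
  qed
  have g0: "\<gamma> 0 = q1" using \<gamma>1[of 0] T by (simp add: q1_def)
  have gT1: "\<gamma> T1 = mirror q1" using \<gamma>2[of T1] T by simp
  have gT: "\<gamma> (T1 + T2) = q1" using \<gamma>2[of "T1 + T2"] T T2 by simp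
  have mne: "mirror q1 \<noteq> q1" using mirror_c[OF c0, of q1] qc by auto
  have zeros: "\<gamma> s = q1 \<or> \<gamma> s = mirror q1" if "s \<in> {0..T1 + T2}" "h (\<gamma> s) = 0" for s
  proof -
    from cases[OF that(1)] show ?thesis
    proof
      assume s: "s \<in> {0..T1}"
      then have "s = 0 \<or> s = T1"
        using pos[of "s + a"] \<gamma>1[OF s] that(2) by (cases "0 < s"; cases "s < T1") (auto simp: T1_def)
      then show ?thesis using g0 gT1 by auto
    next
      assume "s \<in> {T1..T1 + T2}"
      then show ?thesis using chord_in_disc(2)[OF hm q1(1) seg] that(2) by auto
    qed
  qed
  have YU: "Y (\<gamma> s) = L (\<gamma> s - p0)" and XU: "X (\<gamma> s) = c" if "s \<in> {0..T1 + T2}" for s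
    using that \<Gamma>V V(2) X Y by (auto simp: \<Gamma>'_def subset_iff)
  have arcY: "trajectory_arc Y \<gamma> 0 T1"
    unfolding trajectory_arc_def
  proof
    fix s assume s: "s \<in> {0..T1}"
    have "(F l \<circ> (\<lambda>s. s + a) has_vector_derivative 1 *\<^sub>R L (F l (s + a) - p0)) (at s within {0..T1})"
      by (rule vector_diff_chain_within[OF _ Fd]) (auto intro!: derivative_eq_intros)
    then have "((\<lambda>s. F l (s + a)) has_vector_derivative L (F l (s + a) - p0)) (at s within {0..T1})"
      by (simp add: o_def)
    then have "(\<gamma> has_vector_derivative L (F l (s + a) - p0)) (at s within {0..T1})"
      by (rule has_vector_derivative_transform[OF s, rotated]) (use \<gamma>1 in simp)
    then show "(\<gamma> has_vector_derivative Y (\<gamma> s)) (at s within {0..T1})"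
      using YU[of s] \<gamma>1[OF s] s T by simp
  qed
  have arcX: "trajectory_arc X \<gamma> T1 (T1 + T2)"
    unfolding trajectory_arc_def
  proof
    fix s assume s: "s \<in> {T1..T1 + T2}"
    have "((\<lambda>s. mirror q1 + (s - T1) *\<^sub>R c) has_vector_derivative c) (at s within {T1..T1 + T2})"
      by (auto intro!: derivative_eq_intros)
    then have "(\<gamma> has_vector_derivative c) (at s within {T1..T1 + T2})"
      by (rule has_vector_derivative_transform[OF s, rotated]) (use \<gamma>2 in simp)
    then show "(\<gamma> has_vector_derivative X (\<gamma> s)) (at s within {T1..T1 + T2})"
      using XU[of s] s T by simp
  qed
  have "crossing_periodic_orbit U X Y \<Gamma>'"
    unfolding crossing_periodic_orbit_def
  proof (intro exI conjI)
    show "0 < T1 + T2" using T by simp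
    show "\<Gamma>' = \<gamma> ` {0..T1 + T2}" by (rule \<Gamma>'_def)
    show "\<Gamma>' \<subseteq> U" using \<Gamma>V V(2) by blast
    show "\<gamma> (T1 + T2) = \<gamma> 0" using g0 gT by simp
    show "\<exists>s\<in>{0..T1 + T2}. \<gamma> s \<noteq> \<gamma> 0" using g0 gT1 mne T by (intro bexI[of _ T1]) auto
    let ?\<tau> = "\<lambda>i::nat. if i = 0 then 0 else if i = 1 then T1 else T1 + T2"
    show "?\<tau> 0 = 0" "?\<tau> 2 = T1 + T2" by simp_all
    have "\<forall>s\<in>{0..T1}. 0 \<le> h (\<gamma> s)"
    proof
      fix s assume s: "s \<in> {0..T1}"
      then consider "s = 0" | "s = T1" | "0 < s" "s < T1" by fastforce
      then show "0 \<le> h (\<gamma> s)"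
        using g0 gT1 q1 hm pos[of "s + a"] \<gamma>1[OF s] by cases (auto simp: T1_def)
    qed
    moreover have "\<forall>s\<in>{T1..T1 + T2}. h (\<gamma> s) \<le> 0"
      using chord_in_disc(1)[OF hm q1(1) seg] by blast
    ultimately show "\<forall>i<2. ?\<tau> i < ?\<tau> (Suc i) \<and>
           (trajectory_arc X \<gamma> (?\<tau> i) (?\<tau> (Suc i)) \<and> (\<forall>t\<in>{?\<tau> i..?\<tau> (Suc i)}. h (\<gamma> t) \<le> 0) \<or>
            trajectory_arc Y \<gamma> (?\<tau> i) (?\<tau> (Suc i)) \<and> (\<forall>t\<in>{?\<tau> i..?\<tau> (Suc i)}. h (\<gamma> t) \<ge> 0))"
      using arcX arcY T by (auto simp: less_2_cases_iff)
    show "\<Gamma>' \<inter> S1 \<subseteq> crossing_region X Y"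
    proof
      fix z assume "z \<in> \<Gamma>' \<inter> S1"
      then obtain s where s: "s \<in> {0..T1 + T2}" "z = \<gamma> s" "h z = 0"
        by (auto simp: \<Gamma>'_def S1_eq(1))
      have w: "L (q1 - p0) \<bullet> q1 > 0" using q1 by (simp add: W_def)
      have "L (mirror q1 - p0) \<bullet> mirror q1 = - (L (q1 - p0) \<bullet> q1)"
        using L_mirror[OF cyc sym, of "q1 - p0"]
        by (simp add: mirror_simps mirror_p0[OF cyc sym] mirror_inner[OF c0])
      with zeros[OF s(1)] s(2,3) w qc have "(c \<bullet> z) * (L (z - p0) \<bullet> z) > 0"
        by (auto simp: inner_commute[of c] mirror_c[OF c0] mult_neg_neg)
      then show "z \<in> crossing_region X Y"
        using s XU[OF s(1)] YU[OF s(1)] by (simp add: crossing_region_eq S1_eq(1))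
    qed
  qed
  moreover have "\<Gamma>' \<noteq> cyc_set q t"
  proof
    assume eq: "\<Gamma>' = cyc_set q t"
    have "q1 \<in> \<Gamma>'" unfolding \<Gamma>'_def g0[symmetric] by (rule imageI) (use T in auto)
    then have "q1 \<in> cyc_set q t" by (simp add: eq)
    moreover have "q = p0 + flow 0 (q - p0)" "mirror q = p0 + flow t (q - p0)"
      using cyc by (simp_all add: cyc_def)
    \<comment> \<open>Only the ends of the old chord lie on the circle, and both belong to the old
      arc; so \<open>q1\<close> would have the Hamiltonian of \<open>q\<close>.\<close>
    moreover have "q1 = mirror q \<or> q1 = q" if "q1 \<in> closed_segment (mirror q) q"
      using chord_in_disc(2)[OF _ hq that q1(1)] hq by (simp add: h_mirror[OF c0])
    ultimately obtain s where "q1 = p0 + flow s (q - p0)"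
      unfolding cyc_set_def by blast
    then have "wedge (q1 - p0) (L (q1 - p0)) = wedge u (L u)" by (simp add: wedge_flow u_def)
    moreover have "q1 - p0 = l *\<^sub>R flow a u" by (simp add: q1_def F_def)
    ultimately have "(l * l) * wedge u (L u) = wedge u (L u)"
      by (simp add: L_simps wedge_simps wedge_flow)
    moreover have "l * l \<noteq> 1" using l(1) by (metis less_1_mult less_irrefl)
    ultimately show False using wedge_nonzero[OF cyc sym] by (simp add: u_def)
  qed
  ultimately show ?thesis using \<Gamma>V that by blast
qed

lemma at_most_one_two_point_limit_cycle:
  "\<exists>\<^sub>\<le>\<^sub>1 \<Gamma>. crossing_limit_cycle U X Y \<Gamma> \<and> card (\<Gamma> \<inter> S1) = 2"
proof (rule Uniq_I)
  fix \<Gamma>1 \<Gamma>2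
  assume 1: "crossing_limit_cycle U X Y \<Gamma>1 \<and> card (\<Gamma>1 \<inter> S1) = 2"
    and 2: "crossing_limit_cycle U X Y \<Gamma>2 \<and> card (\<Gamma>2 \<inter> S1) = 2"
  obtain q1 t1 where c1: "cyc q1 t1" "\<Gamma>1 = cyc_set q1 t1"
    using 1 orbit_structure unfolding crossing_limit_cycle_def by blast
  obtain q2 t2 where c2: "cyc q2 t2" "\<Gamma>2 = cyc_set q2 t2"
    using 2 orbit_structure unfolding crossing_limit_cycle_def by blast
  have "wedge c (L (rot c)) \<noteq> 0"
  proof
    assume sym: "wedge c (L (rot c)) = 0"
    obtain V where V: "open V" "\<Gamma>1 \<subseteq> V"
      "\<And>\<Gamma>'. periodic_orbit U X Y \<Gamma>' \<Longrightarrow> \<Gamma>' \<subseteq> V \<Longrightarrow> \<Gamma>' = \<Gamma>1"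
      using 1 unfolding crossing_limit_cycle_def by blast
    have "\<Gamma>1 \<subseteq> U"
      using 1 unfolding crossing_limit_cycle_def crossing_periodic_orbit_def by blast
    then obtain \<Gamma>' where \<Gamma>': "crossing_periodic_orbit U X Y \<Gamma>'" "\<Gamma>' \<subseteq> V \<inter> U" "\<Gamma>' \<noteq> \<Gamma>1"
      using cyc_perturb[OF c1(1) sym, of "V \<inter> U"] V(1,2) open_U c1(2) by blast
    \<comment> \<open>A limit cycle is isolated among all Filippov periodic orbits, so the new
      crossing orbit must be recognised as one of them; continuity serves that conversion.\<close>
    have "continuous_on U X" using X by (simp cong: continuous_on_cong)
    moreover have "continuous_on U Y"
    proof -
      have bl: "bounded_linear L" using lin by (rule linear_linear[THEN iffD2])
      have "continuous_on U (\<lambda>z. L (z - p0))"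
        by (intro continuous_intros bounded_linear.continuous_on[OF bl])
      then show ?thesis using Y by (simp cong: continuous_on_cong)
    qed
    ultimately have "periodic_orbit U X Y \<Gamma>'" by (rule crossing_imp_periodic_orbit[OF \<Gamma>'(1)])
    then show False using V(3) \<Gamma>' by blast
  qed
  then have "q1 = q2" by (rule cyc_determined[OF _ c1(1) c2(1)])
  then show "\<Gamma>1 = \<Gamma>2" using cyc_time_unique c1 c2 by blast
qed

end

theorem theoremA:
  fixes U :: "(real^2) set" and X Y :: "real^2 \<Rightarrow> real^2"
  assumes "open U" and "convex U" and "0 \<in> U" and "S1 \<subseteq> U"
    and "(X, Y) \<in> X0 U \<union> X1 U"
  shows "\<exists>\<^sub>\<le>\<^sub>1 \<Gamma>. crossing_limit_cycle U X Y \<Gamma> \<and> card (\<Gamma> \<inter> S1) = 2"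
proof -
  obtain c where X: "\<forall>z\<in>U. X z = c"
    using assms(5) unfolding X0_def X1_def constant_field_def by blast
  obtain A p where Y: "\<forall>z\<in>U. Y z = A *v (z - p)" and A: "trace A = 0" "det A \<noteq> 0"
  proof (cases "linear_center U Y")
    case True
    then show ?thesis using linear_center_matrix that by blast
  next
    case False
    then have "linear_saddle U Y" "\<forall>z\<in>U. divergence Y z = 0"
      using assms(5) unfolding X0_def X1_def by auto
    then show ?thesis using linear_saddle_matrix[OF _ assms(1,3)] that by blast
  qed
  \<comment> \<open>The parameter \<open>- det A\<close> is negative for a center and positive for a
    saddle, which selects the trigonometric or the hyperbolic branch of \<open>Cf\<close> and
    \<open>Sf\<close>.\<close>
  interpret disc_flow U X Y "\<lambda>v. A *v v" c p "- det A"
    using X Y A(2) assms(1) traceless_square[OF A(1)] traceless_wedge_sym[OF A(1)]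
    by (intro disc_flow.intro matrix_vector_mul_linear) auto
  show ?thesis by (rule at_most_one_two_point_limit_cycle)
qed

end
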